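(* Let $f\in C^\infty(2,2)$ be a map-germ, and let $\varepsilon\in\{1,-1\}$. (1) If $f$ is $\mathcal{A}$-equivalent to a lips and $\operatorname{sgn}\,\eta\eta\lambda(0)=\varepsilon$, then $f$ is $\mathcal{A}$-isotopic to $(\varepsilon x_1(x_1^2+x_2^2),x_2)$. Moreover, the two map-germs obtained for $\varepsilon=1$ and $\varepsilon=-1$ are not $\mathcal{A}$-isotopic. (2) If $f$ is $\mathcal{A}$-equivalent to a beaks and $\operatorname{sgn}\,\eta\eta\lambda(0)=\varepsilon$, then $f$ is $\mathcal{A}$-isotopic to $(\varepsilon x_1(x_1^2-x_2^2),x_2)$. Moreover, the two map-germs obtained for $\varepsilon=1$ and $\varepsilon=-1$ are not $\mathcal{A}$-isotopic. (3) If $f$ is $\mathcal{A}$-equivalent to a (planar) swallowtail and $\operatorname{sgn}(\xi\lambda\cdot\eta\eta\eta\lambda)(0)=\varepsilon$, where $\xi$ is a vector field such that $(\xi,\eta)$ is a positive frame at $0$, then $f$ is $\mathcal{A}$-isotopic to $(\varepsilon x_1x_2+x_1^4,x_2)$. Moreover, the two map-germs obtained for $\varepsilon=1$ and $\varepsilon=-1$ are not $\mathcal{A}$-isotopic.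
   Context: All germs are $C^\infty$, and $C^\infty(m,n)$ denotes the set of map-germs $(\mathbb{R}^m,0)\to(\mathbb{R}^n,0)$. Two germs $f,g$ are $\mathcal{A}$-equivalent if $g=\tau\circ f\circ\sigma$ for diffeomorphism-germs $\sigma,\tau$ of source and target at $0$. A germ $f$ is $r$-determined if every germ with the same $r$-jet at $0$ is $\mathcal{A}$-equivalent to $f$. Let $f,g\in C^\infty(m,n)$ be $\mathcal{A}$-equivalent and $r$-determined. They are $\mathcal{A}$-isotopic if there exist continuous curves $\sigma:[0,1]\to \mathrm{Diff}^r(m)$ and $\tau:[0,1]\to\mathrm{Diff}^r(n)$ with $\sigma(0),\tau(0)$ the identity and $j^rg(0)=j^r(\tau(1)\circ f\circ\sigma(1))(0)$, where $\mathrm{Diff}^r(m)$ is the space of $r$-jets at $0$ of diffeomorphism-germs of $(\mathbb{R}^m,0)$. Equivalently, there are orientation-preserving diffeomorphism-germs $\sigma^+$, $\tau^+$ of source and target with $j^rg(0)=j^r(\tau^+\circ f\circ\sigma^+)(0)$. The lips is the germ $(x_1^3+x_1x_2^2,x_2)$, the beaks is $(x_1^3-x_1x_2^2,x_2)$, and the (planar) swallowtail is $(x_1^4+x_1x_2,x_2)$; these germs are finitely determined. For $f\in C^\infty(2,2)$ of corank one at $0$, $\lambda$ is the determinant of the Jacobi matrix of $f$, and $\eta$ is a nowhere vanishing vector field near $0$ in the source with $\eta(p)\in\ker df(p)$ for every $p$ with $\lambda(p)=0$. Expressions such as $\eta\eta\lambda$ and $\xi\lambda$ denote (iterated) directional derivatives.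 "Positive frame" is with respect to the standard orientation of $\mathbb{R}^2$ with coordinates $(x_1,x_2)$.
   Formalization: In (3) the frame (η,ξ), not (ξ,η), is required to be positive at 0: with the printed order the swallowtail itself has sign −1, so it would be A-isotopic to the form with ε=−1, contradicting the "Moreover". *)

theory Defs
  imports "HOL-Analysis.Analysis"
begin

section \<open>Smooth germs and their jets\<close>

text \<open>Iterated directional derivative along the fixed vectors in a list; the head of the list is
  the direction of the last differentiation.\<close>

primrec iter_deriv ::
  "'a::real_normed_vector list \<Rightarrow> ('a \<Rightarrow> 'b::real_normed_vector) \<Rightarrow> 'a \<Rightarrow> 'b" where
  "iter_deriv [] f = f"
| "iter_deriv (v # vs) f = (\<lambda>x. frechet_derivative (iter_deriv vs f) (at x) v)"

text \<open>Intended for open \<open>S\<close>, where it says that \<open>f\<close> is of class \<open>C\<^sup>\<infinity>\<close> on \<open>S\<close>: differentiability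
  of all iterated derivatives makes every one of them continuous.\<close>

definition smooth_on :: "'a::euclidean_space set \<Rightarrow> ('a \<Rightarrow> 'b::euclidean_space) \<Rightarrow> bool" where
  "smooth_on S f \<longleftrightarrow> (\<forall>vs. \<forall>x\<in>S. iter_deriv vs f differentiable (at x))"

definition smooth_near_0 :: "('a::euclidean_space \<Rightarrow> 'b::euclidean_space) \<Rightarrow> bool" where
  "smooth_near_0 f \<longleftrightarrow> (\<exists>U. open U \<and> 0 \<in> U \<and> smooth_on U f)"

text \<open>A germ is given by a representative, an everywhere defined function whose values away from
  \<open>0\<close> are irrelevant. Equality of germs is equality on a neighbourhood of \<open>0\<close>.\<close>

definition smooth_germ :: "(real^'m \<Rightarrow> real^'n) \<Rightarrow> bool" where
  "smooth_germ f \<longleftrightarrow> smooth_near_0 f \<and> f 0 = 0"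

definition diffeo_germ :: "(real^'n \<Rightarrow> real^'n) \<Rightarrow> bool" where
  "diffeo_germ f \<longleftrightarrow> smooth_germ f \<and>
     (\<exists>g. smooth_germ g \<and> (\<forall>\<^sub>F x in nhds 0. g (f x) = x) \<and> (\<forall>\<^sub>F x in nhds 0. f (g x) = x))"

definition A_equivalent :: "(real^'m \<Rightarrow> real^'n) \<Rightarrow> (real^'m \<Rightarrow> real^'n) \<Rightarrow> bool" where
  "A_equivalent f g \<longleftrightarrow>
     (\<exists>\<sigma> \<tau>. diffeo_germ \<sigma> \<and> diffeo_germ \<tau> \<and> (\<forall>\<^sub>F x in nhds 0. g x = \<tau> (f (\<sigma> x))))"

text \<open>The \<open>r\<close>-jet at \<open>0\<close>, represented by the partial derivatives at \<open>0\<close> of order at most \<open>r\<close>.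
  Only finitely many coordinates of the function \<open>jet r f\<close> can be nonzero, so the product topology
  of the function type induces the usual topology on the finite-dimensional space of \<open>r\<close>-jets.\<close>

definition jet :: "nat \<Rightarrow> (real^'m \<Rightarrow> real^'n) \<Rightarrow> (real^'m) list \<Rightarrow> real^'n" where
  "jet r f = (\<lambda>vs. if length vs \<le> r \<and> set vs \<subseteq> Basis then iter_deriv vs f 0 else 0)"

definition r_determined :: "nat \<Rightarrow> (real^'m \<Rightarrow> real^'n) \<Rightarrow> bool" where
  "r_determined r f \<longleftrightarrow> smooth_germ f \<and>
     (\<forall>g. smooth_germ g \<and> jet r g = jet r f \<longrightarrow> A_equivalent f g)"

definition Diff_jets :: "nat \<Rightarrow> ((real^'n) list \<Rightarrow> real^'n) set" where
  "Diff_jets r = jet r ` {\<phi>. diffeo_germ \<phi>}"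

text \<open>The notion is defined only for \<open>r\<close>-determined germs, whence the first two lines. The
  composition of jets in the last line is computed from representatives \<open>\<phi>\<close> and \<open>\<psi>\<close> of the jets
  at the end points of the two curves; it does not depend on their choice.\<close>

definition A_isotopic :: "nat \<Rightarrow> (real^'m \<Rightarrow> real^'n) \<Rightarrow> (real^'m \<Rightarrow> real^'n) \<Rightarrow> bool" where
  "A_isotopic r f g \<longleftrightarrow>
     smooth_germ f \<and> smooth_germ g \<and> A_equivalent f g \<and>
     r_determined r f \<and> r_determined r g \<and>
     (\<exists>\<sigma> \<tau>.
        continuous_on {0..1::real} \<sigma> \<and> \<sigma> ` {0..1} \<subseteq> Diff_jets r \<and> \<sigma> 0 = jet r id \<and>
        continuous_on {0..1::real} \<tau> \<and> \<tau> ` {0..1} \<subseteq> Diff_jets r \<and> \<tau> 0 = jet r id \<and>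
        (\<exists>\<phi> \<psi>. diffeo_germ \<phi> \<and> diffeo_germ \<psi> \<and> jet r \<phi> = \<sigma> 1 \<and> jet r \<psi> = \<tau> 1 \<and>
               jet r g = jet r (\<psi> \<circ> f \<circ> \<phi>)))"


section \<open>The singularities of the plane and their invariants\<close>

definition lips :: "real^2 \<Rightarrow> real^2" where
  "lips x = vector [(x$1)^3 + x$1 * (x$2)^2, x$2]"

definition beaks :: "real^2 \<Rightarrow> real^2" where
  "beaks x = vector [(x$1)^3 - x$1 * (x$2)^2, x$2]"

definition swallowtail :: "real^2 \<Rightarrow> real^2" where
  "swallowtail x = vector [(x$1)^4 + x$1 * x$2, x$2]"

definition lips_sign :: "real \<Rightarrow> real^2 \<Rightarrow> real^2" where
  "lips_sign \<epsilon> x = vector [\<epsilon> * x$1 * ((x$1)^2 + (x$2)^2), x$2]"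

definition beaks_sign :: "real \<Rightarrow> real^2 \<Rightarrow> real^2" where
  "beaks_sign \<epsilon> x = vector [\<epsilon> * x$1 * ((x$1)^2 - (x$2)^2), x$2]"

definition swallowtail_sign :: "real \<Rightarrow> real^2 \<Rightarrow> real^2" where
  "swallowtail_sign \<epsilon> x = vector [\<epsilon> * x$1 * x$2 + (x$1)^4, x$2]"

definition jac_det :: "(real^2 \<Rightarrow> real^2) \<Rightarrow> real^2 \<Rightarrow> real" where
  "jac_det f p = det (jacobian f (at p))"

definition null_field :: "(real^2 \<Rightarrow> real^2) \<Rightarrow> (real^2 \<Rightarrow> real^2) \<Rightarrow> bool" where
  "null_field f \<eta> \<longleftrightarrow>
     (\<exists>U. open U \<and> 0 \<in> U \<and> smooth_on U \<eta> \<and>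
        (\<forall>p\<in>U. \<eta> p \<noteq> 0 \<and> (jac_det f p = 0 \<longrightarrow> frechet_derivative f (at p) (\<eta> p) = 0)))"

definition dir_deriv :: "(real^2 \<Rightarrow> real^2) \<Rightarrow> (real^2 \<Rightarrow> real) \<Rightarrow> real^2 \<Rightarrow> real" where
  "dir_deriv \<xi> h p = frechet_derivative h (at p) (\<xi> p)"

text \<open>Positivity of the ordered pair \<open>(v, w)\<close>; \<open>(e\<^sub>1, e\<^sub>2)\<close> is positive.
  For the swallowtail the order of the null field \<open>\<eta>\<close> and the transverse field \<open>\<xi>\<close> matters. For
  \<open>\<epsilon> x\<^sub>1 x\<^sub>2 + x\<^sub>1\<^sup>4\<close> one has \<open>\<lambda> = \<epsilon> x\<^sub>2 + 4 x\<^sub>1\<^sup>3\<close>, and with \<open>\<eta> = e\<^sub>1\<close>, \<open>\<xi> = e\<^sub>2\<close> the product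
  \<open>\<xi>\<lambda> \<cdot> \<eta>\<eta>\<eta>\<lambda>\<close> is \<open>24 \<epsilon>\<close> at \<open>0\<close>. Hence its sign equals \<open>\<epsilon>\<close> when \<open>(\<eta>, \<xi>)\<close> is
  positive, and \<open>-\<epsilon>\<close> when \<open>(\<xi>, \<eta>)\<close> is positive.\<close>

definition positive_frame :: "real^2 \<Rightarrow> real^2 \<Rightarrow> bool" where
  "positive_frame v w \<longleftrightarrow> det (vector [v, w] :: real^2^2) > 0"

end

theory Submission
  imports Defs
begin

text \<open>Every matrix of positive determinant is joined to the identity, and \<open>\<sigma>(t x)/t\<close> joins a
  diffeomorphism \<open>\<sigma>\<close> to its linear part; hence \<open>\<A>\<close>-isotopy is equivalence by orientation-preserving
  germs, at the level of \<open>r\<close>-jets. The orientations of \<open>\<sigma>\<close> and \<open>\<tau>\<close> in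
  \<open>f = \<tau> \<circ> g \<circ> \<sigma>\<close> can be corrected by linear symmetries of the normal form \<open>g\<close>. These preserve
  the sign of \<open>det d\<tau> \<cdot> det d\<sigma>\<close> for lips and beaks, and the sign of \<open>det d\<sigma>\<close> for the swallowtail.
  Both signs are read off the factorisation \<open>\<lambda>\<^sub>f = (det d\<tau> \<circ> g \<circ> \<sigma>) \<cdot> det d\<sigma> \<cdot> (\<lambda>\<^sub>g \<circ> \<sigma>)\<close>. Conversely,
  determinacy forces \<open>r \<ge> 3\<close> (\<open>r \<ge> 4\<close> for the swallowtail), as otherwise the terms of highest degree
  could be dropped, which makes the fibre over \<open>0\<close> a line; such an \<open>r\<close>-jet still sees the sign.\<close>

text \<open>A-isotopy yields only an equality of r-jets, so whatever separates two normal forms must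
  be readable from a jet. For lips and beaks, \<lambda> is critical at 0, so its second derivative
  along \<eta> at 0 depends on \<eta> only through the kernel vector \<eta>(0), and one constant
  field serves both germs. For the swallowtail the third derivative involves \<eta> along the whole
  singular curve, and two germs with equal jets need not share a null field; the non-isotopy is
  therefore obtained by comparing growth along a half-axis instead of by that invariant. Null
  vectors are controlled through a common feature of the normal forms g: they keep the second
  coordinate. From \<theta> o f = g o \<sigma> it follows that \<sigma>_2 = (\<theta> o f)_2, hence
  d\<sigma>_2 kills the kernel of df, at every point near 0. Smoothness and jets are treated by
  induction on the order with the functions varying: the Leibniz and chain rules reproduce
  expressions of the same kind, so no multi-index formula is required.\<close>

section \<open>Smoothness of finite order\<close>

text \<open>Covers non-differentiable functions as well: \<open>frechet_derivative\<close> is a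
  choice among the derivatives at the point, and both functions have the same ones.\<close>

lemma frechet_derivative_cong_open:
  assumes "open S" "x \<in> S" "\<And>y. y \<in> S \<Longrightarrow> f y = g y"
  shows "frechet_derivative f (at x) = frechet_derivative g (at x)"
proof -
  have "(f has_derivative D) (at x) = (g has_derivative D) (at x)" for D
    using assms has_derivative_transform_within_open[of f D x UNIV S g]
      has_derivative_transform_within_open[of g D x UNIV S f] by auto
  then show ?thesis by (simp add: frechet_derivative_def)
qed

lemma iter_deriv_append: "iter_deriv (vs @ ws) f = iter_deriv vs (iter_deriv ws f)"
  by (induction vs) auto

lemma iter_deriv_cong_open:
  assumes "open S" "\<And>y. y \<in> S \<Longrightarrow> f y = g y" "x \<in> S"
  shows "iter_deriv vs f x = iter_deriv vs g x"
  using assms(3)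
proof (induction vs arbitrary: x)
  case Nil then show ?case using assms(2) by simp
next
  case (Cons v vs)
  then show ?case
    using frechet_derivative_cong_open[OF assms(1) Cons.prems, of "iter_deriv vs f" "iter_deriv vs g"]
    by simp
qed

lemma iter_deriv_cong_ev:
  assumes "\<forall>\<^sub>F y in nhds x. f y = g y"
  shows "iter_deriv vs f x = iter_deriv vs g x"
  using assms iter_deriv_cong_open unfolding eventually_nhds by blast

lemma frechet_derivative_cong_ev:
  assumes "\<forall>\<^sub>F y in nhds x. f y = g y"
  shows "frechet_derivative f (at x) = frechet_derivative g (at x)"
  using assms frechet_derivative_cong_open unfolding eventually_nhds by blast

lemma frechet_derivative_eqI:
  "(f has_derivative f') (at x) \<Longrightarrow> frechet_derivative f (at x) v = f' v"
  by (metis frechet_derivative_at)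

text \<open>Smoothness is cut into finite orders so that closure properties can be proved by
  induction. Derivatives up to order \<open>k\<close> must themselves be differentiable, so
  \<open>ck k\<close> amounts to differentiability of order k + 1.\<close>

definition ck :: "nat \<Rightarrow> 'a::euclidean_space set \<Rightarrow> ('a \<Rightarrow> 'b::euclidean_space) \<Rightarrow> bool" where
  "ck k S f \<longleftrightarrow> (\<forall>vs. length vs \<le> k \<longrightarrow> (\<forall>x\<in>S. iter_deriv vs f differentiable (at x)))"

lemma smooth_on_ck: "smooth_on S f \<longleftrightarrow> (\<forall>k. ck k S f)"
  unfolding smooth_on_def ck_def by blast

lemma ck_0: "ck 0 S f \<longleftrightarrow> (\<forall>x\<in>S. f differentiable (at x))"
  by (simp add: ck_def)

text \<open>Splits off the first differentiation, which is the last list element, whereas the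
  recursion of \<open>iter_deriv\<close> splits off the last one. This is the side on which product
  and chain rules give an explicit derivative.\<close>

lemma ck_Suc:
  "ck (Suc k) S f \<longleftrightarrow> (\<forall>x\<in>S. f differentiable (at x)) \<and> (\<forall>v. ck k S (iter_deriv [v] f))"
proof
  assume L: "ck (Suc k) S f"
  have "iter_deriv (vs @ [v]) f differentiable (at x)" if "length vs \<le> k" "x \<in> S" for vs v x
    using L that unfolding ck_def by (metis Suc_le_mono length_append_singleton)
  moreover have "f differentiable (at x)" if "x \<in> S" for x
    using L that unfolding ck_def by (metis iter_deriv.simps(1) le0 list.size(3))
  ultimately show "(\<forall>x\<in>S. f differentiable (at x)) \<and> (\<forall>v. ck k S (iter_deriv [v] f))"
    unfolding ck_def iter_deriv_append by blast
next
  assume R: "(\<forall>x\<in>S. f differentiable (at x)) \<and> (\<forall>v. ck k S (iter_deriv [v] f))"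
  show "ck (Suc k) S f"
    unfolding ck_def
  proof (intro allI impI ballI)
    fix vs :: "'a list" and x assume vs: "length vs \<le> Suc k" and x: "x \<in> S"
    show "iter_deriv vs f differentiable (at x)"
    proof (cases vs rule: rev_cases)
      case Nil then show ?thesis using R x by simp
    next
      case (snoc ws v)
      then show ?thesis using R x vs unfolding ck_def by (simp add: iter_deriv_append)
    qed
  qed
qed

lemma ck_differentiable: "ck k S f \<Longrightarrow> x \<in> S \<Longrightarrow> f differentiable (at x)"
  by (cases k) (auto simp: ck_0 ck_Suc)

lemma ck_Suc_mono: "ck (Suc k) S f \<Longrightarrow> ck k S f"
  by (auto simp: ck_def)

lemma ck_cong:
  assumes "open S" "\<And>y. y \<in> S \<Longrightarrow> f y = g y" "ck k S g"
  shows "ck k S f"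
  unfolding ck_def
proof (intro allI impI ballI)
  fix vs :: "'a list" and x assume vs: "length vs \<le> k" and x: "x \<in> S"
  have "iter_deriv vs g differentiable (at x)" using assms(3) vs x by (auto simp: ck_def)
  moreover have "iter_deriv vs g y = iter_deriv vs f y" if "y \<in> S" for y
    using assms(1,2) that by (intro iter_deriv_cong_open) auto
  ultimately show "iter_deriv vs f differentiable (at x)"
    using assms(1) x has_derivative_transform_within_open[of "iter_deriv vs g" _ x UNIV S "iter_deriv vs f"]
    unfolding differentiable_def by blast
qed

text \<open>The induction step of all closure properties: an explicit derivative is supplied, and
  its terms are of the same shape at order \<open>k\<close>.\<close>

lemma ck_SucI:
  assumes "open S" "\<And>x. x \<in> S \<Longrightarrow> (f has_derivative f' x) (at x)" "\<And>v. ck k S (\<lambda>x. f' x v)"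
  shows "ck (Suc k) S f"
  unfolding ck_Suc
proof (intro conjI ballI allI)
  fix x assume "x \<in> S" then show "f differentiable at x" using assms(2) differentiableI by blast
next
  fix v
  have "iter_deriv [v] f x = f' x v" if "x \<in> S" for x
    using frechet_derivative_at[OF assms(2)[OF that]] by simp
  then show "ck k S (iter_deriv [v] f)"
    using ck_cong[OF assms(1) _ assms(3)] by blast
qed

lemma ck_const: "ck k S (\<lambda>x. c)"
proof (induction k arbitrary: c)
  case (Suc k)
  then show ?case by (auto simp: ck_Suc frechet_derivative_const)
qed (simp add: ck_0)

lemma ck_has_derivative:
  "ck k S f \<Longrightarrow> x \<in> S \<Longrightarrow> (f has_derivative frechet_derivative f (at x)) (at x)"
  using ck_differentiable frechet_derivative_works by blast

lemma ck_deriv: "ck (Suc k) S f \<Longrightarrow> ck k S (\<lambda>x. frechet_derivative f (at x) v)"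
  using ck_Suc[of k S f] by auto

lemma ck_add:
  assumes "open S" "ck k S f" "ck k S g" shows "ck k S (\<lambda>x. f x + g x)"
  using assms(2,3)
proof (induction k arbitrary: f g)
  case 0 then show ?case by (auto simp: ck_0)
next
  case (Suc k)
  show ?case
    by (rule ck_SucI[OF assms(1) has_derivative_add[OF ck_has_derivative[OF Suc.prems(1)]
        ck_has_derivative[OF Suc.prems(2)]]])
      (auto intro!: Suc.IH ck_deriv Suc.prems)
qed

lemma ck_sum:
  assumes "open S" "finite I" "\<And>i. i \<in> I \<Longrightarrow> ck k S (f i)"
  shows "ck k S (\<lambda>x. \<Sum>i\<in>I. f i x)"
  using assms(2,3) by (induction I rule: finite_induct) (auto intro!: ck_const ck_add assms(1))

lemma ck_scaleR:
  fixes a :: "'a::euclidean_space \<Rightarrow> real"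
  assumes "open S" "ck k S a" "ck k S f" shows "ck k S (\<lambda>x. a x *\<^sub>R f x)"
  using assms(2,3)
proof (induction k arbitrary: a f)
  case 0 then show ?case by (auto simp: ck_0)
next
  case (Suc k)
  show ?case
    by (rule ck_SucI[OF assms(1) has_derivative_scaleR[OF ck_has_derivative[OF Suc.prems(1)]
        ck_has_derivative[OF Suc.prems(2)]]])
      (auto intro!: ck_add Suc.IH ck_deriv Suc.prems assms(1) ck_Suc_mono[OF Suc.prems(1)]
        ck_Suc_mono[OF Suc.prems(2)])
qed

lemma ck_bounded_linear:
  assumes "open S" "bounded_linear L" "ck k S f" shows "ck k S (\<lambda>x. L (f x))"
  using assms(3)
proof (induction k arbitrary: f)
  case 0
  then show ?case
    using differentiableI[OF bounded_linear.has_derivative[OF assms(2) ck_has_derivative[OF 0]]]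
    by (auto simp: ck_0)
next
  case (Suc k)
  show ?case
    by (rule ck_SucI[OF assms(1) bounded_linear.has_derivative[OF assms(2)
          ck_has_derivative[OF Suc.prems]]])
      (auto intro!: Suc.IH ck_deriv Suc.prems)
qed

lemma ck_ident: "ck k S (\<lambda>x. x)"
  by (cases k) (auto simp: ck_0 ck_Suc ck_const)

lemma frechet_derivative_basis:
  fixes f :: "'a::euclidean_space \<Rightarrow> 'b::euclidean_space"
  assumes "f differentiable (at x)"
  shows "frechet_derivative f (at x) w = (\<Sum>b\<in>Basis. (w \<bullet> b) *\<^sub>R frechet_derivative f (at x) b)"
proof -
  have lin: "linear (frechet_derivative f (at x))"
    using assms linear_frechet_derivative by blast
  have "frechet_derivative f (at x) w = frechet_derivative f (at x) (\<Sum>b\<in>Basis. (w \<bullet> b) *\<^sub>R b)"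
    by (simp add: euclidean_representation)
  also have "\<dots> = (\<Sum>b\<in>Basis. (w \<bullet> b) *\<^sub>R frechet_derivative f (at x) b)"
    by (simp only: linear_sum[OF lin] linear_scale[OF lin])
  finally show ?thesis .
qed

text \<open>In the plain chain rule the direction in which \<open>f\<close> is differentiated varies
  with the point. Expanding it in the basis leaves scalars times fixed-direction derivatives of
  \<open>f\<close> composed with \<open>g\<close>, to which an induction hypothesis about
  compositions applies.\<close>

lemma compose_has_derivative_basis:
  fixes f :: "'b::euclidean_space \<Rightarrow> 'c::euclidean_space" and g :: "'a::euclidean_space \<Rightarrow> 'b"
  assumes "g differentiable (at x)" "f differentiable (at (g x))"
  shows "((\<lambda>x. f (g x)) has_derivative
    (\<lambda>v. \<Sum>b\<in>Basis. (frechet_derivative g (at x) v \<bullet> b) *\<^sub>R frechet_derivative f (at (g x)) b)) (at x)"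
proof -
  have "((\<lambda>x. f (g x)) has_derivative
     (\<lambda>v. frechet_derivative f (at (g x)) (frechet_derivative g (at x) v))) (at x)"
    using diff_chain_at[of g _ x f] assms unfolding frechet_derivative_works o_def by blast
  then show ?thesis by (subst (asm) frechet_derivative_basis[OF assms(2)])
qed

lemma ck_compose:
  fixes f :: "'b::euclidean_space \<Rightarrow> 'c::euclidean_space" and g :: "'a::euclidean_space \<Rightarrow> 'b"
  assumes "open S" "ck k S g" "ck k T f" "\<And>x. x \<in> S \<Longrightarrow> g x \<in> T"
  shows "ck k S (\<lambda>x. f (g x))"
  using assms(2,3)
\<comment> \<open>The inner map stays fixed: the derivative of the composite contains derivatives of
  \<open>f\<close> composed with the same \<open>g\<close>, and those of \<open>g\<close> occur only
  as scalar factors.\<close>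
proof (induction k arbitrary: f)
  case 0
  then show ?case
    using assms(4) compose_has_derivative_basis[of g _ f] differentiableI unfolding ck_0 by blast
next
  case (Suc k)
  show ?case
    by (rule ck_SucI[OF assms(1) compose_has_derivative_basis[OF ck_differentiable[OF Suc.prems(1)]
        ck_differentiable[OF Suc.prems(2) assms(4)]]])
      (auto intro!: ck_sum ck_scaleR assms(1) Suc.IH ck_deriv Suc.prems ck_Suc_mono[OF Suc.prems(1)]
         ck_bounded_linear[OF _ bounded_linear_inner_left])
qed

section \<open>Calculus of smooth germs and their jets\<close>

lemma smooth_near_0_ck: "smooth_near_0 f \<longleftrightarrow> (\<exists>S. open S \<and> 0 \<in> S \<and> (\<forall>k. ck k S f))"
  by (simp add: smooth_near_0_def smooth_on_ck)

lemma ck_subset: "ck k S f \<Longrightarrow> T \<subseteq> S \<Longrightarrow> ck k T f"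
  by (auto simp: ck_def)

lemma smooth_near_0_common:
  assumes "smooth_near_0 f" "smooth_near_0 g"
  obtains S where "open S" "0 \<in> S" "\<And>k. ck k S f" "\<And>k. ck k S g"
proof -
  obtain S where S: "open S" "0 \<in> S" "\<And>k. ck k S f"
    using assms(1) unfolding smooth_near_0_ck by blast
  obtain T where T: "open T" "0 \<in> T" "\<And>k. ck k T g"
    using assms(2) unfolding smooth_near_0_ck by blast
  show ?thesis
    by (rule that[of "S \<inter> T"]) (use S T in \<open>auto intro: ck_subset\<close>)
qed

lemma smooth_near_0_cong_ev:
  assumes "\<forall>\<^sub>F x in nhds 0. f x = g x" "smooth_near_0 g"
  shows "smooth_near_0 f"
proof -
  obtain S where S: "open S" "0 \<in> S" "\<And>k. ck k S g"
    using assms(2) unfolding smooth_near_0_ck by blast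
  obtain T where T: "open T" "0 \<in> T" "\<And>x. x \<in> T \<Longrightarrow> f x = g x"
    using assms(1) unfolding eventually_nhds by blast
  have "ck k (S \<inter> T) f" for k
    by (rule ck_cong[where g = g]) (use S T in \<open>auto intro: ck_subset\<close>)
  then show ?thesis unfolding smooth_near_0_ck using S T by blast
qed

lemma smooth_near_0_const: "smooth_near_0 (\<lambda>x. c)"
  unfolding smooth_near_0_ck using ck_const by blast

lemma smooth_near_0_ident: "smooth_near_0 (\<lambda>x. x)"
  unfolding smooth_near_0_ck using ck_ident by blast

lemma smooth_near_0_add:
  assumes "smooth_near_0 f" "smooth_near_0 g" shows "smooth_near_0 (\<lambda>x. f x + g x)"
  by (rule smooth_near_0_common[OF assms]) (auto simp: smooth_near_0_ck intro: ck_add)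

lemma smooth_near_0_scaleR:
  fixes a :: "'a::euclidean_space \<Rightarrow> real"
  assumes "smooth_near_0 a" "smooth_near_0 f" shows "smooth_near_0 (\<lambda>x. a x *\<^sub>R f x)"
  by (rule smooth_near_0_common[OF assms]) (auto simp: smooth_near_0_ck intro: ck_scaleR)

lemma smooth_near_0_mult:
  fixes a b :: "'a::euclidean_space \<Rightarrow> real"
  assumes "smooth_near_0 a" "smooth_near_0 b" shows "smooth_near_0 (\<lambda>x. a x * b x)"
  using smooth_near_0_scaleR[OF assms] by simp

lemma smooth_near_0_power:
  fixes a :: "'a::euclidean_space \<Rightarrow> real"
  assumes "smooth_near_0 a" shows "smooth_near_0 (\<lambda>x. a x ^ n)"
  by (induction n) (auto intro: smooth_near_0_const smooth_near_0_mult assms)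

lemma smooth_near_0_linear:
  assumes "bounded_linear L" "smooth_near_0 f" shows "smooth_near_0 (\<lambda>x. L (f x))"
  using assms ck_bounded_linear unfolding smooth_near_0_ck by metis

lemma smooth_near_0_minus:
  assumes "smooth_near_0 f" shows "smooth_near_0 (\<lambda>x. - f x)"
  by (rule smooth_near_0_linear[OF bounded_linear_minus[OF bounded_linear_ident] assms])

lemma smooth_near_0_diff:
  assumes "smooth_near_0 f" "smooth_near_0 g" shows "smooth_near_0 (\<lambda>x. f x - g x)"
  using smooth_near_0_add[OF assms(1) smooth_near_0_minus[OF assms(2)]] by simp

lemma smooth_near_0_nth:
  assumes "smooth_near_0 f" shows "smooth_near_0 (\<lambda>x. f x $ i)"
  by (rule smooth_near_0_linear[OF bounded_linear_vec_nth assms])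

lemma smooth_near_0_inner:
  assumes "smooth_near_0 f" shows "smooth_near_0 (\<lambda>x. f x \<bullet> b)"
  by (rule smooth_near_0_linear[OF bounded_linear_inner_left assms])

lemma smooth_near_0_sum:
  assumes "finite I" "\<And>i. i \<in> I \<Longrightarrow> smooth_near_0 (f i)"
  shows "smooth_near_0 (\<lambda>x. \<Sum>i\<in>I. f i x)"
  using assms by (induction I rule: finite_induct) (auto intro: smooth_near_0_const smooth_near_0_add)

lemma vector_2_decomp: "(vector [a, b] :: real^2) = a *\<^sub>R axis 1 1 + b *\<^sub>R axis 2 1"
  by (simp add: vec_eq_iff forall_2 axis_def)

lemma smooth_near_0_vector_2:
  assumes "smooth_near_0 a" "smooth_near_0 b"
  shows "smooth_near_0 (\<lambda>x. vector [a x, b x] :: real^2)"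
  unfolding vector_2_decomp
  by (intro smooth_near_0_add smooth_near_0_scaleR smooth_near_0_const assms)

lemma smooth_near_0_differentiable:
  assumes "smooth_near_0 f" shows "\<forall>\<^sub>F x in nhds 0. f differentiable (at x)"
  using assms ck_differentiable unfolding smooth_near_0_ck eventually_nhds by metis

lemma smooth_near_0_differentiable_0: "smooth_near_0 f \<Longrightarrow> f differentiable (at 0)"
  using smooth_near_0_differentiable eventually_nhds_x_imp_x by blast

lemma smooth_near_0_isCont: "smooth_near_0 f \<Longrightarrow> isCont f 0"
  using smooth_near_0_differentiable_0 differentiable_imp_continuous_within by blast

lemma smooth_near_0_deriv:
  assumes "smooth_near_0 f" shows "smooth_near_0 (\<lambda>x. frechet_derivative f (at x) v)"
  using assms ck_deriv unfolding smooth_near_0_ck by metis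

lemma smooth_near_0_iter_deriv:
  assumes "smooth_near_0 f" shows "smooth_near_0 (iter_deriv vs f)"
  using assms by (induction vs) (auto intro: smooth_near_0_deriv)

lemma smooth_near_0_compose:
  assumes "smooth_near_0 f" "smooth_near_0 g" "g 0 = 0"
  shows "smooth_near_0 (\<lambda>x. f (g x))"
proof -
  obtain S where S: "open S" "0 \<in> S" "\<And>k. ck k S g"
    using assms(2) unfolding smooth_near_0_ck by blast
  obtain T where T: "open T" "0 \<in> T" "\<And>k. ck k T f"
    using assms(1) unfolding smooth_near_0_ck by blast
  have "continuous_on S g"
    by (intro differentiable_imp_continuous_on differentiable_at_imp_differentiable_on
        ck_differentiable[OF S(3)])
  then have "open (S \<inter> g -` T)"
    using S(1) T(1) by (simp add: continuous_on_open_vimage Int_commute)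
  moreover have "ck k (S \<inter> g -` T) (\<lambda>x. f (g x))" for k
    using calculation by (intro ck_compose[of _ k g T f]) (auto intro: ck_subset S T)
  ultimately show ?thesis
    unfolding smooth_near_0_ck using S(2) T(2) assms(3) by (intro exI[of _ "S \<inter> g -` T"]) auto
qed

lemma ev_compose:
  assumes "\<forall>\<^sub>F y in nhds 0. P y" "isCont g 0" "g 0 = 0"
  shows "\<forall>\<^sub>F x in nhds 0. P (g x)"
proof -
  have "filterlim g (nhds 0) (nhds 0)"
    using assms(2,3) unfolding isCont_def by (metis filterlim_at_within_not_equal tendsto_at_iff_tendsto_nhds)
  then show ?thesis using assms(1) filterlim_iff by blast
qed

lemma ev_ev: "\<forall>\<^sub>F x in nhds (a::'a::topological_space). P x \<Longrightarrow> \<forall>\<^sub>F x in nhds a. \<forall>\<^sub>F y in nhds x. P y"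
  by (simp add: eventually_eventually)

lemma dir_deriv_eq_sum:
  assumes "h differentiable (at p)"
  shows "dir_deriv \<xi> h p = \<xi> p $ 1 * frechet_derivative h (at p) (axis 1 1)
     + \<xi> p $ 2 * frechet_derivative h (at p) (axis 2 1)"
proof -
  have lin: "linear (frechet_derivative h (at p))"
    using assms linear_frechet_derivative by blast
  have "\<xi> p = \<xi> p $ 1 *\<^sub>R axis 1 1 + \<xi> p $ 2 *\<^sub>R axis 2 1"
    by (simp add: vec_eq_iff forall_2 axis_def)
  then have "dir_deriv \<xi> h p = frechet_derivative h (at p) (\<xi> p $ 1 *\<^sub>R axis 1 1 + \<xi> p $ 2 *\<^sub>R axis 2 1)"
    unfolding dir_deriv_def by simp
  then show ?thesis by (simp add: linear_add[OF lin] linear_scale[OF lin])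
qed

lemma smooth_near_0_dir_deriv:
  assumes "smooth_near_0 \<xi>" "smooth_near_0 h"
  shows "smooth_near_0 (dir_deriv \<xi> h)"
proof (rule smooth_near_0_cong_ev)
  show "\<forall>\<^sub>F p in nhds 0. dir_deriv \<xi> h p = \<xi> p $ 1 * frechet_derivative h (at p) (axis 1 1)
     + \<xi> p $ 2 * frechet_derivative h (at p) (axis 2 1)"
    using smooth_near_0_differentiable[OF assms(2)]
    by eventually_elim (rule dir_deriv_eq_sum)
qed (intro smooth_near_0_add smooth_near_0_mult smooth_near_0_nth smooth_near_0_deriv assms)

section \<open>Equality of jets at the origin and its compatibility with sums, products and
  compositions\<close>

definition jet_eq :: "nat \<Rightarrow> ('a::euclidean_space \<Rightarrow> 'b::euclidean_space) \<Rightarrow> ('a \<Rightarrow> 'b) \<Rightarrow> bool" where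
  "jet_eq k f g \<longleftrightarrow>
     (\<forall>vs. set vs \<subseteq> Basis \<and> length vs \<le> k \<longrightarrow> iter_deriv vs f 0 = iter_deriv vs g 0)"

text \<open>\<open>jet_eq\<close> lives on arbitrary Euclidean spaces because components, Jacobian
  determinants and scalar factors have to be compared too; on maps between vectors it is equality of
  \<open>jet\<close>.\<close>

lemma jet_eq_iff: "jet r f = jet r g \<longleftrightarrow> jet_eq r f g"
  unfolding jet_def jet_eq_def fun_eq_iff by auto

lemma jet_eq_0: "jet_eq 0 f g \<longleftrightarrow> f 0 = g 0"
  by (simp add: jet_eq_def)

lemma jet_eq_value: "jet_eq k f g \<Longrightarrow> f 0 = g 0"
  unfolding jet_eq_def by (metis empty_subsetI iter_deriv.simps(1) le0 list.set(1) list.size(3))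

lemma jet_eq_mono: "jet_eq k f g \<Longrightarrow> l \<le> k \<Longrightarrow> jet_eq l f g"
  by (auto simp: jet_eq_def)

lemma jet_eq_refl: "jet_eq k f f" by (simp add: jet_eq_def)

lemma jet_eq_sym: "jet_eq k f g \<Longrightarrow> jet_eq k g f" by (simp add: jet_eq_def)

lemma jet_eq_trans: "jet_eq k f g \<Longrightarrow> jet_eq k g h \<Longrightarrow> jet_eq k f h" by (simp add: jet_eq_def)

lemma jet_eq_cong_ev:
  assumes "\<forall>\<^sub>F x in nhds 0. f x = g x" shows "jet_eq k f g"
  unfolding jet_eq_def using iter_deriv_cong_ev[OF assms] by blast

lemma jet_eq_Suc:
  "jet_eq (Suc k) f g \<longleftrightarrow> f 0 = g 0 \<and>
     (\<forall>b\<in>Basis. jet_eq k (\<lambda>x. frechet_derivative f (at x) b) (\<lambda>x. frechet_derivative g (at x) b))"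
  (is "?L \<longleftrightarrow> ?R")
proof
  assume L: ?L
  have "iter_deriv (vs @ [b]) f 0 = iter_deriv (vs @ [b]) g 0"
    if "set vs \<subseteq> Basis" "length vs \<le> k" "b \<in> Basis" for vs b
    using L that unfolding jet_eq_def by (metis Suc_le_mono Un_insert_right empty_subsetI
        insert_subset length_append_singleton list.set(1) list.simps(15) set_append sup_bot.right_neutral)
  then show ?R
    using jet_eq_value[OF L] unfolding jet_eq_def by (auto simp: iter_deriv_append)
next
  assume R: ?R
  show ?L
    unfolding jet_eq_def
  proof (intro allI impI)
    fix vs :: "'a list" assume vs: "set vs \<subseteq> Basis \<and> length vs \<le> Suc k"
    show "iter_deriv vs f 0 = iter_deriv vs g 0"
    proof (cases vs rule: rev_cases)
      case Nil then show ?thesis using R by simp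
    next
      case (snoc ws b)
      then show ?thesis using R vs unfolding jet_eq_def by (simp add: iter_deriv_append)
    qed
  qed
qed

text \<open>The jet of order \<open>Suc k\<close> consists of the value and the
  \<open>k\<close>-jets of the partial derivatives. These are jets of germs, so the derivative
  formulas are required on a neighbourhood.\<close>

lemma jet_eq_SucI:
  fixes f g :: "'a::euclidean_space \<Rightarrow> 'b::euclidean_space"
  assumes "f 0 = g 0"
    and "\<forall>\<^sub>F x in nhds 0. (f has_derivative f' x) (at x)"
    and "\<forall>\<^sub>F x in nhds 0. (g has_derivative g' x) (at x)"
    and "\<And>b. b \<in> Basis \<Longrightarrow> jet_eq k (\<lambda>x. f' x b) (\<lambda>x. g' x b)"
  shows "jet_eq (Suc k) f g"
  unfolding jet_eq_Suc
proof (intro conjI ballI assms(1))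
  fix b :: 'a assume b: "b \<in> Basis"
  have ev: "\<forall>\<^sub>F x in nhds 0. frechet_derivative h (at x) b = h' x b"
    if "\<forall>\<^sub>F x in nhds 0. (h has_derivative h' x) (at x)" for h :: "'a \<Rightarrow> 'b" and h'
    using that by eventually_elim (metis frechet_derivative_at)
  show "jet_eq k (\<lambda>x. frechet_derivative f (at x) b) (\<lambda>x. frechet_derivative g (at x) b)"
    using jet_eq_cong_ev[OF ev[OF assms(2)]] jet_eq_sym[OF jet_eq_cong_ev[OF ev[OF assms(3)]]]
      assms(4)[OF b] jet_eq_trans by blast
qed

lemma jet_eq_deriv:
  "jet_eq (Suc k) f g \<Longrightarrow> b \<in> Basis \<Longrightarrow>
    jet_eq k (\<lambda>x. frechet_derivative f (at x) b) (\<lambda>x. frechet_derivative g (at x) b)"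
  by (simp add: jet_eq_Suc)

lemma smooth_near_0_has_derivative:
  assumes "smooth_near_0 f"
  shows "\<forall>\<^sub>F x in nhds 0. (f has_derivative frechet_derivative f (at x)) (at x)"
  using smooth_near_0_differentiable[OF assms] by (simp add: frechet_derivative_works)

lemma jet_eq_add:
  assumes "smooth_near_0 f" "smooth_near_0 f'" "smooth_near_0 g" "smooth_near_0 g'"
    and "jet_eq k f f'" "jet_eq k g g'"
  shows "jet_eq k (\<lambda>x. f x + g x) (\<lambda>x. f' x + g' x)"
  using assms
proof (induction k arbitrary: f f' g g')
  case 0 then show ?case by (simp add: jet_eq_0)
next
  case (Suc k)
  have D: "\<forall>\<^sub>F x in nhds 0. ((\<lambda>x. f x + g x) has_derivative
       (\<lambda>v. frechet_derivative f (at x) v + frechet_derivative g (at x) v)) (at x)"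
    if "smooth_near_0 f" "smooth_near_0 g" for f g :: "'a \<Rightarrow> 'b"
    using smooth_near_0_has_derivative[OF that(1)] smooth_near_0_has_derivative[OF that(2)]
    by eventually_elim (rule has_derivative_add)
  show ?case
  proof (rule jet_eq_SucI[OF _ D D])
    show "f 0 + g 0 = f' 0 + g' 0" using Suc.prems(5,6) by (simp add: jet_eq_Suc)
    fix b :: 'a assume b: "b \<in> Basis"
    show "jet_eq k (\<lambda>x. frechet_derivative f (at x) b + frechet_derivative g (at x) b)
       (\<lambda>x. frechet_derivative f' (at x) b + frechet_derivative g' (at x) b)"
      by (intro Suc.IH smooth_near_0_deriv jet_eq_deriv Suc.prems b)
  qed (use Suc.prems in auto)
qed

lemma jet_eq_scaleR:
  fixes a a' :: "'a::euclidean_space \<Rightarrow> real"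
  assumes "smooth_near_0 a" "smooth_near_0 a'" "smooth_near_0 f" "smooth_near_0 f'"
    and "jet_eq k a a'" "jet_eq k f f'"
  shows "jet_eq k (\<lambda>x. a x *\<^sub>R f x) (\<lambda>x. a' x *\<^sub>R f' x)"
  using assms
proof (induction k arbitrary: a a' f f')
  case 0 then show ?case by (simp add: jet_eq_0)
next
  case (Suc k)
  have D: "\<forall>\<^sub>F x in nhds 0. ((\<lambda>x. a x *\<^sub>R f x) has_derivative
       (\<lambda>v. a x *\<^sub>R frechet_derivative f (at x) v + frechet_derivative a (at x) v *\<^sub>R f x)) (at x)"
    if "smooth_near_0 a" "smooth_near_0 f" for a :: "'a \<Rightarrow> real" and f :: "'a \<Rightarrow> 'b"
    using smooth_near_0_has_derivative[OF that(1)] smooth_near_0_has_derivative[OF that(2)]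
    by eventually_elim (rule has_derivative_scaleR)
  show ?case
  proof (rule jet_eq_SucI[OF _ D D])
    show "a 0 *\<^sub>R f 0 = a' 0 *\<^sub>R f' 0" using Suc.prems(5,6) by (simp add: jet_eq_Suc)
    fix b :: 'a assume b: "b \<in> Basis"
    show "jet_eq k (\<lambda>x. a x *\<^sub>R frechet_derivative f (at x) b + frechet_derivative a (at x) b *\<^sub>R f x)
       (\<lambda>x. a' x *\<^sub>R frechet_derivative f' (at x) b + frechet_derivative a' (at x) b *\<^sub>R f' x)"
      by (intro jet_eq_add Suc.IH smooth_near_0_scaleR smooth_near_0_deriv jet_eq_deriv Suc.prems b
          jet_eq_mono[OF Suc.prems(5)] jet_eq_mono[OF Suc.prems(6)]) auto
  qed (use Suc.prems in auto)
qed

lemma jet_eq_linear: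
  fixes f f' :: "'a::euclidean_space \<Rightarrow> 'b::euclidean_space" and L :: "'b \<Rightarrow> 'c::euclidean_space"
  assumes "bounded_linear L" "smooth_near_0 f" "smooth_near_0 f'" "jet_eq k f f'"
  shows "jet_eq k (\<lambda>x. L (f x)) (\<lambda>x. L (f' x))"
  using assms(2-)
proof (induction k arbitrary: f f')
  case 0 then show ?case by (simp add: jet_eq_0)
next
  case (Suc k)
  have D: "\<forall>\<^sub>F x in nhds 0. ((\<lambda>x. L (f x)) has_derivative
       (\<lambda>v. L (frechet_derivative f (at x) v))) (at x)" if "smooth_near_0 f" for f :: "'a \<Rightarrow> 'b"
    using smooth_near_0_has_derivative[OF that]
    by eventually_elim (rule bounded_linear.has_derivative[OF assms(1)])
  show ?case
  proof (rule jet_eq_SucI[OF _ D D])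
    show "L (f 0) = L (f' 0)" using Suc.prems(3) by (simp add: jet_eq_Suc)
    fix b :: 'a assume b: "b \<in> Basis"
    show "jet_eq k (\<lambda>x. L (frechet_derivative f (at x) b)) (\<lambda>x. L (frechet_derivative f' (at x) b))"
      by (rule Suc.IH; intro smooth_near_0_deriv jet_eq_deriv Suc.prems b)
  qed (use Suc.prems in auto)
qed

lemma jet_eq_sum:
  assumes "finite I" "\<And>i. i \<in> I \<Longrightarrow> smooth_near_0 (f i) \<and> smooth_near_0 (g i) \<and> jet_eq k (f i) (g i)"
  shows "jet_eq k (\<lambda>x. \<Sum>i\<in>I. f i x) (\<lambda>x. \<Sum>i\<in>I. g i x)"
  using assms
proof (induction I rule: finite_induct)
  case (insert i I)
  then show ?case by (simp add: jet_eq_add smooth_near_0_sum)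
qed (simp add: jet_eq_refl)

lemma smooth_compose_has_derivative:
  assumes "smooth_near_0 f" "smooth_near_0 g" "g 0 = 0"
  shows "\<forall>\<^sub>F x in nhds 0. ((\<lambda>x. f (g x)) has_derivative
    (\<lambda>v. \<Sum>b\<in>Basis. (frechet_derivative g (at x) v \<bullet> b) *\<^sub>R frechet_derivative f (at (g x)) b)) (at x)"
  using smooth_near_0_differentiable[OF assms(2)]
    ev_compose[OF smooth_near_0_differentiable[OF assms(1)] smooth_near_0_isCont[OF assms(2)] assms(3)]
  by eventually_elim (rule compose_has_derivative_basis)

lemma jet_eq_compose:
  fixes f f' :: "'b::euclidean_space \<Rightarrow> 'c::euclidean_space" and g g' :: "'a::euclidean_space \<Rightarrow> 'b"
  assumes "smooth_near_0 f" "smooth_near_0 f'" "smooth_near_0 g" "smooth_near_0 g'"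
    and "jet_eq k f f'" "jet_eq k g g'" and "g 0 = 0"
  shows "jet_eq k (\<lambda>x. f (g x)) (\<lambda>x. f' (g' x))"
  using assms(1,2,5,6)
proof (induction k arbitrary: f f')
  case 0 then show ?case using assms(7) by (simp add: jet_eq_0)
next
  case (Suc k)
  have g0: "g' 0 = 0" using jet_eq_value[OF Suc.prems(4)] assms(7) by simp
  show ?case
  proof (rule jet_eq_SucI[OF _ smooth_compose_has_derivative[of f g] smooth_compose_has_derivative[of f' g']])
    show "f (g 0) = f' (g' 0)" using Suc.prems(3) assms(7) g0 by (simp add: jet_eq_Suc)
    fix b :: 'a assume b: "b \<in> Basis"
    show "jet_eq k
       (\<lambda>x. \<Sum>c\<in>Basis. (frechet_derivative g (at x) b \<bullet> c) *\<^sub>R frechet_derivative f (at (g x)) c)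
       (\<lambda>x. \<Sum>c\<in>Basis. (frechet_derivative g' (at x) b \<bullet> c) *\<^sub>R frechet_derivative f' (at (g' x)) c)"
    proof (rule jet_eq_sum, simp, intro conjI)
      fix c :: 'b assume c: "c \<in> Basis"
      have s: "smooth_near_0 (\<lambda>x. frechet_derivative f (at (g x)) c)"
        "smooth_near_0 (\<lambda>x. frechet_derivative f' (at (g' x)) c)"
        using smooth_near_0_compose[OF smooth_near_0_deriv] assms(3,4,7) g0 Suc.prems(1,2) by blast+
      show "smooth_near_0 (\<lambda>x. (frechet_derivative g (at x) b \<bullet> c) *\<^sub>R frechet_derivative f (at (g x)) c)"
        "smooth_near_0 (\<lambda>x. (frechet_derivative g' (at x) b \<bullet> c) *\<^sub>R frechet_derivative f' (at (g' x)) c)"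
        by (intro smooth_near_0_scaleR smooth_near_0_inner smooth_near_0_deriv assms s)+
      \<comment> \<open>The induction hypothesis takes a derivative of \<open>f\<close> and the jets
        of the inner maps lowered by one order; their full order is consumed by the scalar factors,
        which contain derivatives of the inner maps.\<close>
      have "jet_eq k (\<lambda>x. frechet_derivative f (at (g x)) c) (\<lambda>x. frechet_derivative f' (at (g' x)) c)"
        by (rule Suc.IH; intro smooth_near_0_deriv jet_eq_deriv Suc.prems c
            jet_eq_mono[OF Suc.prems(4)]) simp
      then show "jet_eq k
         (\<lambda>x. (frechet_derivative g (at x) b \<bullet> c) *\<^sub>R frechet_derivative f (at (g x)) c)
         (\<lambda>x. (frechet_derivative g' (at x) b \<bullet> c) *\<^sub>R frechet_derivative f' (at (g' x)) c)"
        by (intro jet_eq_scaleR smooth_near_0_inner smooth_near_0_deriv assms s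
            jet_eq_linear[OF bounded_linear_inner_left] jet_eq_deriv[OF Suc.prems(4) b])
    qed
  qed (use assms(3,4,7) g0 Suc.prems in auto)
qed

section \<open>Germs of diffeomorphisms and the Jacobian determinant\<close>

lemma smooth_germD: "smooth_germ f \<Longrightarrow> smooth_near_0 f" "smooth_germ f \<Longrightarrow> f 0 = 0"
  by (auto simp: smooth_germ_def)

lemma smooth_germ_isCont: "smooth_germ f \<Longrightarrow> isCont f 0"
  by (simp add: smooth_germD smooth_near_0_isCont)

lemma smooth_germ_ev_compose:
  assumes "\<forall>\<^sub>F y in nhds 0. P y" "smooth_germ g" shows "\<forall>\<^sub>F x in nhds 0. P (g x)"
  using ev_compose[OF assms(1) smooth_germ_isCont[OF assms(2)]] assms(2) by (simp add: smooth_germD)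

lemma smooth_germ_compose:
  "smooth_germ f \<Longrightarrow> smooth_germ g \<Longrightarrow> smooth_germ (\<lambda>x. f (g x))"
  by (auto simp: smooth_germ_def intro: smooth_near_0_compose)

lemma smooth_germ_cong_ev:
  assumes "\<forall>\<^sub>F x in nhds 0. f x = g x" "smooth_germ g" shows "smooth_germ f"
  using smooth_near_0_cong_ev[OF assms(1)] eventually_nhds_x_imp_x[OF assms(1)] assms(2)
  by (auto simp: smooth_germ_def)

lemma diffeo_germ_smooth: "diffeo_germ f \<Longrightarrow> smooth_germ f"
  by (simp add: diffeo_germ_def)

lemma diffeo_germ_inverse:
  assumes "diffeo_germ f"
  obtains g where "diffeo_germ g" "\<forall>\<^sub>F x in nhds 0. g (f x) = x" "\<forall>\<^sub>F x in nhds 0. f (g x) = x"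
  using assms unfolding diffeo_germ_def by blast

lemma diffeo_germ_compose:
  assumes "diffeo_germ f" "diffeo_germ g" shows "diffeo_germ (\<lambda>x. f (g x))"
proof -
  obtain f' where f': "smooth_germ f'" "\<forall>\<^sub>F x in nhds 0. f' (f x) = x" "\<forall>\<^sub>F x in nhds 0. f (f' x) = x"
    using assms(1) by (auto simp: diffeo_germ_def)
  obtain g' where g': "smooth_germ g'" "\<forall>\<^sub>F x in nhds 0. g' (g x) = x" "\<forall>\<^sub>F x in nhds 0. g (g' x) = x"
    using assms(2) by (auto simp: diffeo_germ_def)
  have "\<forall>\<^sub>F x in nhds 0. g' (f' (f (g x))) = x"
    using smooth_germ_ev_compose[OF f'(2) diffeo_germ_smooth[OF assms(2)]] g'(2)
    by eventually_elim simp
  moreover have "\<forall>\<^sub>F x in nhds 0. f (g (g' (f' x))) = x"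
    using smooth_germ_ev_compose[OF g'(3) f'(1)] f'(3) by eventually_elim simp
  ultimately show ?thesis
    unfolding diffeo_germ_def
    using smooth_germ_compose[OF diffeo_germ_smooth[OF assms(1)] diffeo_germ_smooth[OF assms(2)]]
      smooth_germ_compose[OF g'(1) f'(1)] by blast
qed

lemma smooth_germ_id: "smooth_germ (\<lambda>x. x)"
  by (simp add: smooth_germ_def smooth_near_0_ident)

lemma diffeo_germ_id: "diffeo_germ (\<lambda>x. x)"
  unfolding diffeo_germ_def using smooth_germ_id by (auto intro: exI[of _ "\<lambda>x. x"])

lemma smooth_germ_matrix: "smooth_germ (\<lambda>x. A *v x)"
  by (simp add: smooth_germ_def smooth_near_0_linear[OF matrix_vector_mul_bounded_linear smooth_near_0_ident])

lemma diffeo_germ_matrix: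
  fixes A :: "real^'n^'n"
  assumes "det A \<noteq> 0" shows "diffeo_germ (\<lambda>x. A *v x)"
proof -
  obtain B where "A ** B = mat 1" "B ** A = mat 1"
    using assms invertible_det_nz[of A] unfolding invertible_def by blast
  then show ?thesis
    unfolding diffeo_germ_def using smooth_germ_matrix
    by (intro conjI exI[of _ "\<lambda>x. B *v x"]) (auto simp: matrix_vector_mul_assoc)
qed

section \<open>A-equivalence and the invariance of determinacy under it\<close>

lemma A_equivalent_sym:
  assumes "smooth_germ f" "A_equivalent f g" shows "A_equivalent g f"
proof -
  obtain \<sigma> \<tau> where st: "diffeo_germ \<sigma>" "diffeo_germ \<tau>" "\<forall>\<^sub>F x in nhds 0. g x = \<tau> (f (\<sigma> x))"
    using assms(2) by (auto simp: A_equivalent_def)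
  obtain \<sigma>' where s': "diffeo_germ \<sigma>'" "\<forall>\<^sub>F x in nhds 0. \<sigma>' (\<sigma> x) = x" "\<forall>\<^sub>F x in nhds 0. \<sigma> (\<sigma>' x) = x"
    by (rule diffeo_germ_inverse[OF st(1)])
  obtain \<tau>' where t': "diffeo_germ \<tau>'" "\<forall>\<^sub>F x in nhds 0. \<tau>' (\<tau> x) = x" "\<forall>\<^sub>F x in nhds 0. \<tau> (\<tau>' x) = x"
    by (rule diffeo_germ_inverse[OF st(2)])
  have "\<forall>\<^sub>F x in nhds 0. f x = \<tau>' (g (\<sigma>' x))"
    using smooth_germ_ev_compose[OF st(3) diffeo_germ_smooth[OF s'(1)]] s'(3)
      smooth_germ_ev_compose[OF t'(2) assms(1)]
    by eventually_elim simp
  then show ?thesis unfolding A_equivalent_def using s'(1) t'(1) by blast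
qed

lemma A_equivalent_trans:
  assumes "A_equivalent f g" "A_equivalent g h" shows "A_equivalent f h"
proof -
  obtain \<sigma> \<tau> where st: "diffeo_germ \<sigma>" "diffeo_germ \<tau>" "\<forall>\<^sub>F x in nhds 0. g x = \<tau> (f (\<sigma> x))"
    using assms(1) by (auto simp: A_equivalent_def)
  obtain \<sigma>' \<tau>' where st': "diffeo_germ \<sigma>'" "diffeo_germ \<tau>'" "\<forall>\<^sub>F x in nhds 0. h x = \<tau>' (g (\<sigma>' x))"
    using assms(2) by (auto simp: A_equivalent_def)
  have "\<forall>\<^sub>F x in nhds 0. h x = \<tau>' (\<tau> (f (\<sigma> (\<sigma>' x))))"
    using smooth_germ_ev_compose[OF st(3) diffeo_germ_smooth[OF st'(1)]] st'(3)
    by eventually_elim simp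
  then show ?thesis
    unfolding A_equivalent_def
    by (intro exI[of _ "\<lambda>x. \<sigma> (\<sigma>' x)"] exI[of _ "\<lambda>x. \<tau>' (\<tau> x)"])
      (simp add: diffeo_germ_compose st st')
qed

lemma A_equivalent_smooth:
  assumes "smooth_germ f" "A_equivalent f g" shows "smooth_germ g"
  using assms smooth_germ_cong_ev smooth_germ_compose diffeo_germ_smooth
  unfolding A_equivalent_def by metis

lemma jet_eq_sandwich:
  assumes "smooth_germ \<tau>" "smooth_germ g" "smooth_germ h" "smooth_germ \<sigma>" "jet_eq k g h"
  shows "jet_eq k (\<lambda>x. \<tau> (g (\<sigma> x))) (\<lambda>x. \<tau> (h (\<sigma> x)))"
proof -
  note D = smooth_germD
  have "jet_eq k (\<lambda>x. g (\<sigma> x)) (\<lambda>x. h (\<sigma> x))"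
    by (rule jet_eq_compose[OF D(1) D(1) D(1) D(1) assms(5) jet_eq_refl D(2)])
      (fact assms)+
  moreover note D(1)[OF smooth_germ_compose[OF assms(2,4)]] D(1)[OF smooth_germ_compose[OF assms(3,4)]]
  ultimately show ?thesis
    using jet_eq_compose[where f = \<tau> and f' = \<tau> and g = "\<lambda>x. g (\<sigma> x)" and g' = "\<lambda>x. h (\<sigma> x)" and k = k]
      D(1)[OF assms(1)] D(2)[OF assms(2)] D(2)[OF assms(4)] by (simp add: jet_eq_refl)
qed

text \<open>If f = \<tau> o g o \<sigma> and \<open>h\<close> has the jet of \<open>g\<close>, then
  \<tau> o h o \<sigma> has the jet of \<open>f\<close>. It is therefore A-equivalent to
  \<open>f\<close>, and so is \<open>h\<close>.\<close>

lemma r_determined_A_equivalent: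
  assumes f: "r_determined r f" and fg: "A_equivalent f g"
  shows "r_determined r g"
  unfolding r_determined_def
proof (intro conjI allI impI)
  have sf: "smooth_germ f" using f by (simp add: r_determined_def)
  show sg: "smooth_germ g" using A_equivalent_smooth[OF sf fg] .
  obtain \<sigma> \<tau> where st: "diffeo_germ \<sigma>" "diffeo_germ \<tau>" "\<forall>\<^sub>F x in nhds 0. f x = \<tau> (g (\<sigma> x))"
    using A_equivalent_sym[OF sf fg] by (auto simp: A_equivalent_def)
  fix h assume h: "smooth_germ h \<and> jet r h = jet r g"
  have "jet_eq r (\<lambda>x. \<tau> (h (\<sigma> x))) (\<lambda>x. \<tau> (g (\<sigma> x)))"
    by (rule jet_eq_sandwich[OF diffeo_germ_smooth[OF st(2)] _ sg diffeo_germ_smooth[OF st(1)]])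
      (use h in \<open>auto simp: jet_eq_iff\<close>)
  then have "jet r (\<lambda>x. \<tau> (h (\<sigma> x))) = jet r f"
    unfolding jet_eq_iff using jet_eq_sym[OF jet_eq_cong_ev[OF st(3)]] jet_eq_trans by blast
  moreover have "smooth_germ (\<lambda>x. \<tau> (h (\<sigma> x)))"
    using smooth_germ_compose diffeo_germ_smooth st(1,2) h by metis
  ultimately have "A_equivalent f (\<lambda>x. \<tau> (h (\<sigma> x)))"
    using f by (simp add: r_determined_def)
  moreover have "A_equivalent (\<lambda>x. \<tau> (h (\<sigma> x))) h"
  proof (rule A_equivalent_sym)
    show "A_equivalent h (\<lambda>x. \<tau> (h (\<sigma> x)))"
      unfolding A_equivalent_def using st(1,2) by (intro exI[of _ \<sigma>] exI[of _ \<tau>]) simp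
  qed (use h in simp)
  ultimately show "A_equivalent g h"
    by (rule A_equivalent_trans[OF A_equivalent_sym[OF sf fg] A_equivalent_trans])
qed

section \<open>Chain rule and Jacobian determinant\<close>

lemma frechet_derivative_chain:
  assumes "g differentiable (at x)" "f differentiable (at (g x))"
  shows "frechet_derivative (\<lambda>x. f (g x)) (at x) v =
    frechet_derivative f (at (g x)) (frechet_derivative g (at x) v)"
proof -
  have "((\<lambda>x. f (g x)) has_derivative
     (\<lambda>v. frechet_derivative f (at (g x)) (frechet_derivative g (at x) v))) (at x)"
    using diff_chain_at[of g _ x f] assms unfolding frechet_derivative_works o_def by blast
  from frechet_derivative_at[OF this] show ?thesis by metis
qed

lemma frechet_derivative_nth:
  assumes "f differentiable (at x)"
  shows "frechet_derivative (\<lambda>x. f x $ i) (at x) v = frechet_derivative f (at x) v $ i"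
proof -
  have "((\<lambda>x. f x $ i) has_derivative (\<lambda>v. frechet_derivative f (at x) v $ i)) (at x)"
    using bounded_linear.has_derivative[OF bounded_linear_vec_nth] assms
    unfolding frechet_derivative_works by blast
  from frechet_derivative_at[OF this] show ?thesis by metis
qed

lemma jac_det_formula:
  "jac_det f p = frechet_derivative f (at p) (axis 1 1) $ 1 * frechet_derivative f (at p) (axis 2 1) $ 2
     - frechet_derivative f (at p) (axis 2 1) $ 1 * frechet_derivative f (at p) (axis 1 1) $ 2"
  by (simp add: jac_det_def jacobian_def det_2 matrix_def)

lemma jac_det_cong_ev:
  assumes "\<forall>\<^sub>F x in nhds p. f x = g x" shows "jac_det f p = jac_det g p"
  unfolding jac_det_formula frechet_derivative_cong_ev[OF assms] ..

lemma jac_det_compose: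
  assumes "g differentiable (at x)" "f differentiable (at (g x))"
  shows "jac_det (\<lambda>x. f (g x)) x = jac_det f (g x) * jac_det g x"
proof -
  have "frechet_derivative (\<lambda>x. f (g x)) (at x) =
      frechet_derivative f (at (g x)) \<circ> frechet_derivative g (at x)"
    using frechet_derivative_chain[OF assms] by (simp add: fun_eq_iff)
  then show ?thesis
    unfolding jac_det_def jacobian_def
    using matrix_compose[OF linear_frechet_derivative[OF assms(1)] linear_frechet_derivative[OF assms(2)]]
    by (simp add: det_mul)
qed

lemma smooth_near_0_jac_det: "smooth_near_0 f \<Longrightarrow> smooth_near_0 (jac_det f)"
  unfolding jac_det_formula[abs_def]
  by (intro smooth_near_0_diff smooth_near_0_mult smooth_near_0_nth smooth_near_0_deriv)

lemma jac_det_matrix: "jac_det (\<lambda>x. A *v x) p = det A"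
proof -
  have "frechet_derivative (\<lambda>x. A *v x) (at p) = (\<lambda>x. A *v x)"
    using frechet_derivative_at[OF bounded_linear_imp_has_derivative[OF matrix_vector_mul_bounded_linear]]
    by metis
  then show ?thesis by (simp add: jac_det_def jacobian_def matrix_of_matrix_vector_mul)
qed

lemma jac_det_id: "jac_det (\<lambda>x. x) p = 1"
  using jac_det_matrix[of "mat 1" p] by simp

lemma jac_det_diffeo_inverse:
  assumes "smooth_germ f" "smooth_germ g" "\<forall>\<^sub>F x in nhds 0. g (f x) = x"
  shows "jac_det g 0 * jac_det f 0 = 1"
  using jac_det_compose[of f 0 g] jac_det_cong_ev[OF assms(3)] assms(1,2)
  by (simp add: smooth_germD smooth_near_0_differentiable_0 jac_det_id)

lemma jac_det_diffeo_nonzero: "diffeo_germ f \<Longrightarrow> jac_det f 0 \<noteq> 0"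
  unfolding diffeo_germ_def using jac_det_diffeo_inverse[of f] by fastforce

lemma smooth_germ_differentiable_compose:
  assumes "smooth_germ f" "smooth_germ g"
  shows "\<forall>\<^sub>F x in nhds 0. f differentiable (at (g x))"
  by (rule smooth_germ_ev_compose[OF smooth_near_0_differentiable assms(2)])
    (simp add: smooth_germD assms)

text \<open>The factorisation behind all sign computations. It is needed on a neighbourhood since
  \<lambda> is afterwards differentiated up to three times.\<close>

lemma jac_det_compose3:
  assumes "smooth_germ \<tau>" "smooth_germ g" "smooth_germ \<sigma>" "\<forall>\<^sub>F x in nhds 0. f x = \<tau> (g (\<sigma> x))"
  shows "\<forall>\<^sub>F x in nhds 0. jac_det f x = jac_det \<tau> (g (\<sigma> x)) * jac_det \<sigma> x * jac_det g (\<sigma> x)"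
  using smooth_germ_differentiable_compose[OF assms(1) smooth_germ_compose[OF assms(2,3)]]
    smooth_germ_differentiable_compose[OF assms(2,3)]
    smooth_near_0_differentiable[OF smooth_germD(1)[OF assms(3)]]
    smooth_near_0_differentiable[OF smooth_germD(1)[OF smooth_germ_compose[OF assms(2,3)]]]
    ev_ev[OF assms(4)]
proof eventually_elim
  case (elim x)
  have "jac_det f x = jac_det (\<lambda>x. \<tau> (g (\<sigma> x))) x"
    using elim(5) by (rule jac_det_cong_ev)
  also have "\<dots> = jac_det \<tau> (g (\<sigma> x)) * (jac_det g (\<sigma> x) * jac_det \<sigma> x)"
    by (subst jac_det_compose[of "\<lambda>x. g (\<sigma> x)"]) (simp_all add: elim jac_det_compose)
  finally show ?case by simp
qed

lemma jet_eq_mult: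
  fixes a a' :: "'a::euclidean_space \<Rightarrow> real"
  assumes "smooth_near_0 a" "smooth_near_0 a'" "smooth_near_0 f" "smooth_near_0 f'"
    and "jet_eq k a a'" "jet_eq k f f'"
  shows "jet_eq k (\<lambda>x. a x * f x) (\<lambda>x. a' x * f' x)"
  using jet_eq_scaleR[OF assms] by simp

lemma jet_eq_diff:
  assumes "smooth_near_0 f" "smooth_near_0 f'" "smooth_near_0 g" "smooth_near_0 g'"
    and "jet_eq k f f'" "jet_eq k g g'"
  shows "jet_eq k (\<lambda>x. f x - g x) (\<lambda>x. f' x - g' x)"
  using jet_eq_add[OF assms(1,2) smooth_near_0_minus[OF assms(3)] smooth_near_0_minus[OF assms(4)] assms(5)
      jet_eq_linear[OF bounded_linear_minus[OF bounded_linear_ident] assms(3,4,6)]] by simp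

text \<open>The determinant is polynomial in the first derivatives, hence the loss of exactly one
  order.\<close>

lemma jet_eq_jac_det:
  assumes "smooth_near_0 f" "smooth_near_0 g" "jet_eq (Suc k) f g"
  shows "jet_eq k (jac_det f) (jac_det g)"
  unfolding jac_det_formula[abs_def]
  by (intro jet_eq_diff jet_eq_mult jet_eq_linear[OF bounded_linear_vec_nth] smooth_near_0_mult
      smooth_near_0_nth smooth_near_0_deriv assms jet_eq_deriv) simp_all

section \<open>Orientation-preserving diffeomorphisms and isotopy\<close>

lemma det_pos_path:
  fixes B :: "real^2^2"
  assumes "det B > 0"
  obtains M where "continuous_on {0..1::real} M" "\<And>t. t \<in> {0..1} \<Longrightarrow> det (M t) > 0"
    "M 0 = B" "M 1 = mat 1"
proof -
  \<comment> \<open>In complex notation \<open>B z = (p + i q) z + (r + i s) cnj z\<close> has determinant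
    \<open>|p + i q|\<^sup>2 - |r + i s|\<^sup>2\<close>: shrink the conjugate part while moving \<open>p + i q\<close> to \<open>1\<close> in the punctured plane.\<close>
  define Q R S :: "real^2^2" where "Q = vector [vector [0, -1], vector [1, 0]]"
    and "R = vector [vector [1, 0], vector [0, -1]]" and "S = vector [vector [0, 1], vector [1, 0]]"
  define p q r s where "p = (B$1$1 + B$2$2) / 2" and "q = (B$2$1 - B$1$2) / 2"
    and "r = (B$1$1 - B$2$2) / 2" and "s = (B$1$2 + B$2$1) / 2"
  have detN: "det (x *\<^sub>R mat 1 + y *\<^sub>R Q + u *\<^sub>R R + v *\<^sub>R S) = x\<^sup>2 + y\<^sup>2 - (u\<^sup>2 + v\<^sup>2)" for x y u v :: real
    by (simp add: det_2 Q_def R_def S_def mat_def power2_eq_square algebra_simps)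
  have B: "p *\<^sub>R mat 1 + q *\<^sub>R Q + r *\<^sub>R R + s *\<^sub>R S = B"
    by (simp add: vec_eq_iff forall_2 Q_def R_def S_def mat_def p_def q_def r_def s_def field_simps)
  define a where "a = Complex p q"
  have a2: "(cmod a)\<^sup>2 > r\<^sup>2 + s\<^sup>2"
    using detN[of p q r s] assms unfolding B by (simp add: a_def cmod_power2)
  moreover have "0 \<le> r\<^sup>2 + s\<^sup>2" by simp
  ultimately have "(cmod a)\<^sup>2 > 0" by linarith
  then have a0: "a \<noteq> 0" by auto
  have "path_connected (- {0::complex})"
    by (rule path_connected_punctured_universe) simp
  then obtain \<gamma> where g: "path \<gamma>" "path_image \<gamma> \<subseteq> - {0}" "pathstart \<gamma> = a" "pathfinish \<gamma> = 1"
    using a0 unfolding path_connected_def by (metis ComplI singletonD one_neq_zero)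
  have gc: "continuous_on {0..1} \<gamma>" using g(1) by (simp add: path_def)
  \<comment> \<open>Shrinking by \<open>1 - t\<close> alone could fail where
    \<open>\<gamma> t\<close> comes close to 0. The factor \<open>cmod (\<gamma> t) / cmod a\<close>
    makes the conjugate part scale with \<open>\<gamma> t\<close>, so positivity at every
    \<open>t\<close> reduces to positivity of \<open>det B\<close>.\<close>
  define k where "k t = (1 - t) * (cmod (\<gamma> t) / cmod a)" for t
  define M where "M t = Re (\<gamma> t) *\<^sub>R mat 1 + Im (\<gamma> t) *\<^sub>R Q + (k t * r) *\<^sub>R R + (k t * s) *\<^sub>R S" for t
  show ?thesis
  proof (rule that[of M])
    show "continuous_on {0..1} M"
      unfolding M_def k_def using a0 by (intro continuous_intros gc) auto
    show "M 0 = B"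
      using g(3) a0 B by (simp add: M_def k_def pathstart_def a_def)
    show "M 1 = mat 1"
      using g(4) by (simp add: M_def k_def pathfinish_def)
    fix t :: real assume t: "t \<in> {0..1}"
    have gt: "cmod (\<gamma> t) > 0" using g(2) t unfolding path_image_def by auto
    have "(1 - t)\<^sup>2 \<le> 1" using t by (simp add: power_le_one)
    then have "(1 - t)\<^sup>2 * (r\<^sup>2 + s\<^sup>2) \<le> r\<^sup>2 + s\<^sup>2"
      by (intro mult_left_le_one_le) auto
    then have "(1 - t)\<^sup>2 * (r\<^sup>2 + s\<^sup>2) < (cmod a)\<^sup>2" using a2 by simp
    then have "(1 - t)\<^sup>2 * (r\<^sup>2 + s\<^sup>2) / (cmod a)\<^sup>2 < 1"
      using a0 by (simp add: divide_less_eq)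
    then have "(cmod (\<gamma> t))\<^sup>2 * ((1 - t)\<^sup>2 * (r\<^sup>2 + s\<^sup>2) / (cmod a)\<^sup>2) < (cmod (\<gamma> t))\<^sup>2 * 1"
      using gt by (intro mult_strict_left_mono) auto
    moreover have "(k t * r)\<^sup>2 + (k t * s)\<^sup>2 = (cmod (\<gamma> t))\<^sup>2 * ((1 - t)\<^sup>2 * (r\<^sup>2 + s\<^sup>2) / (cmod a)\<^sup>2)"
    proof -
      have "(k t * r)\<^sup>2 + (k t * s)\<^sup>2 = (k t)\<^sup>2 * (r\<^sup>2 + s\<^sup>2)"
        by (simp add: power_mult_distrib algebra_simps)
      then show ?thesis by (simp add: k_def power_mult_distrib power_divide)
    qed
    ultimately show "det (M t) > 0"
      unfolding M_def detN by (simp add: cmod_power2)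
  qed
qed

text \<open>Each differentiation contributes one factor \<open>c\<close>. The identity is proved
  near 0, since the next differentiation needs it at neighbouring points. It computes the jets of
  the rescaled germs \<sigma>(t x)/t.\<close>

lemma iter_deriv_scale:
  fixes \<sigma> :: "real^'n \<Rightarrow> real^'n"
  assumes "smooth_near_0 \<sigma>"
  shows "\<forall>\<^sub>F x in nhds 0. iter_deriv vs (\<lambda>x. L *v \<sigma> (c *\<^sub>R x)) x =
    c ^ length vs *\<^sub>R (L *v iter_deriv vs \<sigma> (c *\<^sub>R x))"
proof (induction vs)
  case Nil then show ?case by simp
next
  case (Cons v vs)
  have "\<forall>\<^sub>F x in nhds 0. iter_deriv vs \<sigma> differentiable (at (c *\<^sub>R x))"
    by (rule ev_compose[OF smooth_near_0_differentiable[OF smooth_near_0_iter_deriv[OF assms]]])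
      (auto intro!: continuous_intros)
  with ev_ev[OF Cons.IH] show ?case
  proof eventually_elim
    case (elim x)
    let ?h = "iter_deriv vs \<sigma>" and ?c = "c ^ length vs"
    have "((\<lambda>x. ?c *\<^sub>R (L *v ?h (c *\<^sub>R x))) has_derivative
        (\<lambda>v. ?c *\<^sub>R (L *v (frechet_derivative ?h (at (c *\<^sub>R x)) (c *\<^sub>R v))))) (at x)"
    proof -
      have "((\<lambda>x. c *\<^sub>R x) has_derivative (\<lambda>v. c *\<^sub>R v)) (at x)"
        by (auto intro!: derivative_eq_intros)
      from diff_chain_at[OF this, of ?h] elim(2)
      have "((\<lambda>x. ?h (c *\<^sub>R x)) has_derivative
          (\<lambda>v. frechet_derivative ?h (at (c *\<^sub>R x)) (c *\<^sub>R v))) (at x)"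
        unfolding frechet_derivative_works o_def by blast
      from bounded_linear.has_derivative[OF matrix_vector_mul_bounded_linear this]
      show ?thesis by (rule has_derivative_scaleR_right)
    qed
    from frechet_derivative_at[OF this]
    have "frechet_derivative (\<lambda>x. ?c *\<^sub>R (L *v ?h (c *\<^sub>R x))) (at x) v =
        ?c *\<^sub>R (L *v (frechet_derivative ?h (at (c *\<^sub>R x)) (c *\<^sub>R v)))"
      by metis
    also have "\<dots> = ?c *\<^sub>R c *\<^sub>R (L *v (frechet_derivative ?h (at (c *\<^sub>R x)) v))"
      using linear_scale[OF linear_frechet_derivative[OF elim(2)], of c v]
      by (simp add: matrix_vector_mult_scaleR)
    finally show ?case
      using frechet_derivative_cong_ev[OF elim(1)] by (simp add: mult.commute)
  qed
qed

lemma iter_deriv_const: "vs \<noteq> [] \<Longrightarrow> iter_deriv vs (\<lambda>x. c) = (\<lambda>x. 0)"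
proof (induction vs)
  case (Cons v vs) then show ?case by (cases "vs = []") auto
qed simp

lemma iter_deriv_id:
  "iter_deriv vs (\<lambda>x. x) 0 = (if length vs = 1 then hd vs else 0)"
proof (cases vs rule: rev_cases)
  case (snoc ws v)
  then show ?thesis
    by (cases "ws = []") (auto simp: iter_deriv_append frechet_derivative_ident iter_deriv_const)
qed simp

lemma diffeo_jet_path:
  fixes \<sigma> :: "real^2 \<Rightarrow> real^2"
  assumes "diffeo_germ \<sigma>" "jac_det \<sigma> 0 > 0"
  shows "\<exists>J. continuous_on {0..1::real} J \<and> J ` {0..1} \<subseteq> Diff_jets r \<and> J 0 = jet r id \<and> J 1 = jet r \<sigma>"
proof -
  define A where "A = matrix (frechet_derivative \<sigma> (at 0))"
  have s: "smooth_near_0 \<sigma>" "\<sigma> 0 = 0"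
    using diffeo_germ_smooth[OF assms(1)] by (auto simp: smooth_germ_def)
  have dA: "det A > 0" using assms(2) by (simp add: A_def jac_det_def jacobian_def)
  have A: "frechet_derivative \<sigma> (at 0) v = A *v v" for v
    unfolding A_def using linear_frechet_derivative[OF smooth_near_0_differentiable_0[OF s(1)]]
    by (simp add: matrix_works)
  \<comment> \<open>The matrix path starts at the inverse of the linear part, because at
    \<open>t = 0\<close> it has to cancel the linear part \<open>A\<close> that remains of
    \<sigma>(t x)/t; it ends at the identity, so that \<sigma> itself is left at
    \<open>t = 1\<close>.\<close>
  obtain B where B: "A ** B = mat 1" "B ** A = mat 1"
    using dA invertible_det_nz[of A] unfolding invertible_def by fastforce
  have "det A * det B = 1" using B(1) by (metis det_I det_mul)
  then have "det B > 0" using dA by (metis zero_less_mult_pos zero_less_one)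
  then obtain M where M: "continuous_on {0..1::real} M" "\<And>t. t \<in> {0..1} \<Longrightarrow> det (M t) > 0"
    "M 0 = B" "M 1 = mat 1" by (rule det_pos_path) blast
  \<comment> \<open>For \<open>t > 0\<close> this is the jet of \<open>x \<mapsto> M t (\<sigma> (t x) / t)\<close>, and it extends continuously to \<open>t = 0\<close>.\<close>
  define J where "J t vs = (if length vs \<le> r \<and> set vs \<subseteq> Basis then
     if vs = [] then 0 else t ^ (length vs - 1) *\<^sub>R (M t *v iter_deriv vs \<sigma> 0) else 0)" for t :: real and vs
  have J0: "J 0 = jet r (\<lambda>x. x)"
  proof
    fix vs :: "(real^2) list"
    consider "vs = []" | v where "vs = [v]" | "length vs \<ge> 2"
      by (cases vs; cases "tl vs") auto
    then show "J 0 vs = jet r (\<lambda>x. x) vs"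
    proof cases
      case (2 v)
      have "B *v (A *v v) = v" using B(2) by (simp add: matrix_vector_mul_assoc)
      then show ?thesis using 2 by (simp add: J_def jet_def A M(3) frechet_derivative_ident)
    qed (auto simp: J_def jet_def iter_deriv_id)
  qed
  have Jt: "\<exists>\<phi>. diffeo_germ \<phi> \<and> J t = jet r \<phi>" if t: "0 < t" "t \<le> 1" for t
  proof -
    \<comment> \<open>Rescaling turns a derivative of order n into t^n times itself, and the factor
      \<open>1 / t\<close> lowers the exponent to the \<open>length vs - 1\<close> of
      \<open>J\<close>.\<close>
    let ?L = "(1 / t) *\<^sub>R M t" and ?C = "t *\<^sub>R mat 1 :: real^2^2"
    have "det (M t) \<noteq> 0" using M(2)[of t] t by simp
    then have "det ?L \<noteq> 0" "det ?C \<noteq> 0" using t by (auto simp: det_2 mat_def field_simps)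
    then have "diffeo_germ (\<lambda>x. ?L *v \<sigma> (?C *v x))"
      using diffeo_germ_compose[OF diffeo_germ_matrix diffeo_germ_compose[OF assms(1) diffeo_germ_matrix]]
      by blast
    moreover have C: "?C *v x = t *\<^sub>R x" for x
      by (simp add: scaleR_matrix_vector_assoc[symmetric])
    moreover have "J t = jet r (\<lambda>x. ?L *v \<sigma> (t *\<^sub>R x))"
    proof
      fix vs :: "(real^2) list"
      have "iter_deriv vs (\<lambda>x. ?L *v \<sigma> (t *\<^sub>R x)) 0 = t ^ length vs *\<^sub>R (?L *v iter_deriv vs \<sigma> 0)"
        using eventually_nhds_x_imp_x[OF iter_deriv_scale[OF s(1)]] by simp
      then show "J t vs = jet r (\<lambda>x. ?L *v \<sigma> (t *\<^sub>R x)) vs"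
        using t s(2) by (cases vs) (auto simp: J_def jet_def scaleR_matrix_vector_assoc[symmetric])
    qed
    ultimately show ?thesis by auto
  qed
  have "continuous_on {0..1} J"
  proof (rule continuous_on_coordinatewise_then_product)
    fix vs :: "(real^2) list"
    have "linear (\<lambda>N::real^2^2. N *v c)" for c :: "real^2"
      by (rule linearI) (simp_all add: matrix_vector_mult_add_rdistrib scaleR_matrix_vector_assoc)
    then have c: "continuous_on {0..1} (\<lambda>t. M t *v c)" for c :: "real^2"
      using continuous_on_compose2[OF linear_continuous_on M(1), of "\<lambda>N. N *v c" UNIV]
      by (simp add: linear_conv_bounded_linear)
    show "continuous_on {0..1} (\<lambda>t. J t vs)"
    proof (cases "(length vs \<le> r \<and> set vs \<subseteq> Basis) \<and> vs \<noteq> []")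
      case True
      then have eq: "(\<lambda>t. J t vs) = (\<lambda>t. t ^ (length vs - 1) *\<^sub>R (M t *v iter_deriv vs \<sigma> 0))"
        by (simp add: J_def)
      show ?thesis unfolding eq by (intro continuous_intros c)
    next
      case False
      then have "J t vs = 0" for t by (auto simp: J_def)
      then show ?thesis by simp
    qed
  qed
  moreover have "J ` {0..1} \<subseteq> Diff_jets r"
  proof
    fix j assume "j \<in> J ` {0..1}"
    then obtain t where "0 \<le> t" "t \<le> 1" "j = J t" by auto
    then show "j \<in> Diff_jets r"
      using Jt[of t] J0 diffeo_germ_id unfolding Diff_jets_def by (cases "t = 0") auto
  qed
  moreover have "J 0 = jet r id" using J0 by (simp add: id_def)
  moreover have "J 1 = jet r \<sigma>"
    using s(2) M(4) by (auto simp: J_def jet_def fun_eq_iff)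
  ultimately show ?thesis by blast
qed

text \<open>Equality of germs is assumed instead of equality of jets, so that A-equivalence and the
  determinacy of \<open>g\<close> come from the same data; only the two paths of jets remain to be
  supplied.\<close>

lemma A_isotopicI:
  fixes f g :: "real^2 \<Rightarrow> real^2"
  assumes "r_determined r f" "diffeo_germ \<phi>" "diffeo_germ \<psi>" "jac_det \<phi> 0 > 0" "jac_det \<psi> 0 > 0"
    and "\<forall>\<^sub>F x in nhds 0. g x = \<psi> (f (\<phi> x))"
  shows "A_isotopic r f g"
proof -
  have sf: "smooth_germ f" using assms(1) by (simp add: r_determined_def)
  have eq: "A_equivalent f g" using assms(2,3,6) unfolding A_equivalent_def by blast
  have "jet r g = jet r (\<psi> \<circ> f \<circ> \<phi>)"
    unfolding jet_eq_iff using jet_eq_cong_ev[OF assms(6)] by (simp add: o_def)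
  then show ?thesis
    unfolding A_isotopic_def
    using sf A_equivalent_smooth[OF sf eq] eq assms(1) r_determined_A_equivalent[OF assms(1) eq]
      diffeo_jet_path[OF assms(2,4), of r] diffeo_jet_path[OF assms(3,5), of r] assms(2,3) by metis
qed

text \<open>A jet of order at least 1 determines the Jacobian determinant at 0, continuously and
  without zeros on \<open>Diff_jets r\<close>. Along the path it starts at 1, so by the intermediate
  value theorem it stays positive.\<close>

lemma Diff_jets_path_jac_det_pos:
  fixes \<phi> :: "real^2 \<Rightarrow> real^2"
  assumes "continuous_on {0..1::real} J" "J ` {0..1} \<subseteq> Diff_jets r" "J 0 = jet r id" "J 1 = jet r \<phi>"
    and "r \<ge> 1"
  shows "jac_det \<phi> 0 > 0"
proof -
  define D where "D j = j [axis 1 1] $ 1 * j [axis 2 1] $ 2 - j [axis 2 1] $ 1 * j [axis 1 1] $ 2"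
    for j :: "(real^2) list \<Rightarrow> real^2"
  have D: "D (jet r \<theta>) = jac_det \<theta> 0" for \<theta>
    using assms(5) by (simp add: D_def jet_def jac_det_formula)
  have J: "D (J t) \<noteq> 0" if "t \<in> {0..1}" for t
    using assms(2) that D jac_det_diffeo_nonzero unfolding Diff_jets_def by fastforce
  have c: "continuous_on {0..1} (\<lambda>t. D (J t))"
    unfolding D_def by (intro continuous_intros continuous_on_product_then_coordinatewise[OF assms(1)])
  have "D (J 0) = 1" using D[of id] jac_det_id by (simp add: assms(3) id_def)
  then have "D (J 1) > 0"
    using IVT2'[of "\<lambda>t. D (J t)" 1 0 0] c J by force
  then show ?thesis using D assms(4) by simp
qed

lemma A_isotopicD:
  fixes f g :: "real^2 \<Rightarrow> real^2"
  assumes "A_isotopic r f g" "r \<ge> 1"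
  obtains \<phi> \<psi> where "diffeo_germ \<phi>" "diffeo_germ \<psi>" "jac_det \<phi> 0 > 0" "jac_det \<psi> 0 > 0"
    "jet_eq r g (\<lambda>x. \<psi> (f (\<phi> x)))"
proof -
  obtain \<sigma> \<tau> \<phi> \<psi> where *: "continuous_on {0..1::real} \<sigma>" "\<sigma> ` {0..1} \<subseteq> Diff_jets r" "\<sigma> 0 = jet r id"
    "continuous_on {0..1::real} \<tau>" "\<tau> ` {0..1} \<subseteq> Diff_jets r" "\<tau> 0 = jet r id"
    "diffeo_germ \<phi>" "diffeo_germ \<psi>" "\<sigma> 1 = jet r \<phi>" "\<tau> 1 = jet r \<psi>" "jet r g = jet r (\<psi> \<circ> f \<circ> \<phi>)"
    using assms(1) unfolding A_isotopic_def by metis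
  have "jet_eq r g (\<lambda>x. \<psi> (f (\<phi> x)))"
    using *(11) by (simp add: jet_eq_iff o_def)
  then show ?thesis
    using that[OF *(7,8)] Diff_jets_path_jac_det_pos[OF *(1,2,3,9) assms(2)]
      Diff_jets_path_jac_det_pos[OF *(4,5,6,10) assms(2)] by blast
qed

section \<open>Lips and beaks\<close>

definition dmat :: "real \<Rightarrow> real \<Rightarrow> real^2^2" where
  "dmat a b = vector [vector [a, 0], vector [0, b]]"

lemma dmat_mult: "dmat a b *v x = vector [a * x $ 1, b * x $ 2]"
  by (simp add: dmat_def vec_eq_iff forall_2 matrix_vector_mult_def sum_2)

lemma det_dmat: "det (dmat a b) = a * b"
  by (simp add: dmat_def det_2)

text \<open>One family for two singularities: \<open>d = 1\<close> is the lips and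
  \<open>d = -1\<close> the beaks. The normal form with sign \<epsilon> is its composite with
  \<open>dmat \<epsilon> 1\<close> in the target.\<close>

definition cubic :: "real \<Rightarrow> real^2 \<Rightarrow> real^2" where
  "cubic d x = vector [(x$1)^3 + d * x$1 * (x$2)^2, x$2]"

lemma has_derivative_nth_id: "((\<lambda>x. x $ i) has_derivative (\<lambda>v. v $ i)) (at x)"
  using bounded_linear_imp_has_derivative[OF bounded_linear_vec_nth] by blast

lemma has_derivative_vector_2:
  assumes "(a has_derivative a') F" "(b has_derivative b') F"
  shows "((\<lambda>x. vector [a x, b x] :: real^2) has_derivative (\<lambda>v. vector [a' v, b' v])) F"
  unfolding vector_2_decomp by (intro has_derivative_add has_derivative_scaleR_left assms)

lemma frechet_cubic:
  "frechet_derivative (cubic d) (at x) v =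
     vector [(3 * (x$1)^2 + d * (x$2)^2) * v$1 + 2 * d * x$1 * x$2 * v$2, v$2]"
proof -
  have "((\<lambda>x. (x$1)^3 + d * x$1 * (x$2)^2) has_derivative
      (\<lambda>v. (3 * (x$1)^2 + d * (x$2)^2) * v$1 + 2 * d * x$1 * x$2 * v$2)) (at x)"
    by (auto intro!: derivative_eq_intros has_derivative_nth_id simp: algebra_simps)
  from frechet_derivative_eqI[OF has_derivative_vector_2[OF this has_derivative_nth_id]]
  show ?thesis unfolding cubic_def[abs_def] .
qed

lemma jac_det_cubic: "jac_det (cubic d) x = 3 * (x$1)^2 + d * (x$2)^2"
  by (simp add: jac_det_formula frechet_cubic axis_def)

lemma frechet_swallowtail:
  "frechet_derivative swallowtail (at x) v = vector [(4 * (x$1)^3 + x$2) * v$1 + x$1 * v$2, v$2]"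
proof -
  have "((\<lambda>x. (x$1)^4 + x$1 * x$2) has_derivative
      (\<lambda>v. (4 * (x$1)^3 + x$2) * v$1 + x$1 * v$2)) (at x)"
    by (auto intro!: derivative_eq_intros has_derivative_nth_id simp: algebra_simps)
  from frechet_derivative_eqI[OF has_derivative_vector_2[OF this has_derivative_nth_id]]
  show ?thesis unfolding swallowtail_def[abs_def] .
qed

lemma jac_det_swallowtail: "jac_det swallowtail x = 4 * (x$1)^3 + x$2"
  by (simp add: jac_det_formula frechet_swallowtail axis_def)

lemma vector_2_zero: "(vector [0, 0] :: real^2) = 0"
  by (simp add: vec_eq_iff forall_2)

lemma smooth_germ_cubic: "smooth_germ (cubic d)"
  unfolding smooth_germ_def cubic_def[abs_def]
  by (auto simp: vector_2_zero intro!: smooth_near_0_vector_2 smooth_near_0_add smooth_near_0_mult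
      smooth_near_0_power smooth_near_0_nth smooth_near_0_ident smooth_near_0_const)

lemma smooth_germ_swallowtail: "smooth_germ swallowtail"
  unfolding smooth_germ_def swallowtail_def[abs_def]
  by (auto simp: vector_2_zero intro!: smooth_near_0_vector_2 smooth_near_0_add smooth_near_0_mult
      smooth_near_0_power smooth_near_0_nth smooth_near_0_ident)

lemma dir_deriv_cong_ev:
  assumes "\<forall>\<^sub>F y in nhds x. f y = g y" shows "dir_deriv \<xi> f x = dir_deriv \<xi> g x"
  by (simp add: dir_deriv_def frechet_derivative_cong_ev[OF assms])

lemma ev_dir_deriv_cong:
  assumes "\<forall>\<^sub>F y in nhds x. f y = g y"
  shows "\<forall>\<^sub>F y in nhds x. dir_deriv \<xi> f y = dir_deriv \<xi> g y"
  using ev_ev[OF assms] by eventually_elim (rule dir_deriv_cong_ev)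

lemma dir_deriv_mult:
  assumes "a differentiable (at p)" "b differentiable (at p)"
  shows "dir_deriv \<xi> (\<lambda>x. a x * b x) p = a p * dir_deriv \<xi> b p + dir_deriv \<xi> a p * b p"
proof -
  have "((\<lambda>x. a x * b x) has_derivative
      (\<lambda>v. a p * frechet_derivative b (at p) v + frechet_derivative a (at p) v * b p)) (at p)"
    using assms unfolding frechet_derivative_works by (rule has_derivative_mult)
  then show ?thesis unfolding dir_deriv_def by (rule frechet_derivative_eqI)
qed

lemma dir_deriv_add:
  assumes "a differentiable (at p)" "b differentiable (at p)"
  shows "dir_deriv \<xi> (\<lambda>x. a x + b x) p = dir_deriv \<xi> a p + dir_deriv \<xi> b p"
proof -
  have "((\<lambda>x. a x + b x) has_derivative
      (\<lambda>v. frechet_derivative a (at p) v + frechet_derivative b (at p) v)) (at p)"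
    using assms unfolding frechet_derivative_works by (rule has_derivative_add)
  then show ?thesis unfolding dir_deriv_def by (rule frechet_derivative_eqI)
qed

text \<open>By the Leibniz rule the two terms with second derivatives carry a factor that vanishes
  at 0, so only the doubled mixed term survives, and it depends on the field only through its value
  at 0.\<close>

lemma dir_deriv2_mult_vanishing:
  assumes "smooth_near_0 \<xi>" "smooth_near_0 a" "smooth_near_0 b" "a 0 = 0" "b 0 = 0"
  shows "dir_deriv \<xi> (dir_deriv \<xi> (\<lambda>x. a x * b x)) 0 = 2 * dir_deriv \<xi> a 0 * dir_deriv \<xi> b 0"
proof -
  note sd = smooth_near_0_differentiable_0
  have sa: "smooth_near_0 (dir_deriv \<xi> a)" and sb: "smooth_near_0 (dir_deriv \<xi> b)"
    by (intro smooth_near_0_dir_deriv assms)+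
  have "\<forall>\<^sub>F p in nhds 0. dir_deriv \<xi> (\<lambda>x. a x * b x) p = a p * dir_deriv \<xi> b p + dir_deriv \<xi> a p * b p"
    using smooth_near_0_differentiable[OF assms(2)] smooth_near_0_differentiable[OF assms(3)]
    by eventually_elim (rule dir_deriv_mult)
  from dir_deriv_cong_ev[OF this]
  have "dir_deriv \<xi> (dir_deriv \<xi> (\<lambda>x. a x * b x)) 0 =
     dir_deriv \<xi> (\<lambda>p. a p * dir_deriv \<xi> b p + dir_deriv \<xi> a p * b p) 0" .
  also have "\<dots> = dir_deriv \<xi> (\<lambda>p. a p * dir_deriv \<xi> b p) 0 + dir_deriv \<xi> (\<lambda>p. dir_deriv \<xi> a p * b p) 0"
    by (intro dir_deriv_add sd smooth_near_0_mult sa sb assms)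
  also have "\<dots> = 2 * dir_deriv \<xi> a 0 * dir_deriv \<xi> b 0"
    by (simp add: dir_deriv_mult sd sa sb assms)
  finally show ?thesis .
qed

lemma dir_deriv_nth:
  assumes "smooth_near_0 f"
  shows "dir_deriv \<xi> (\<lambda>x. f x $ i) 0 = frechet_derivative f (at 0) (\<xi> 0) $ i"
  unfolding dir_deriv_def by (intro frechet_derivative_nth smooth_near_0_differentiable_0 assms)

lemma cubic_hessian:
  assumes "smooth_germ \<tau>" "smooth_germ \<sigma>" "smooth_near_0 \<eta>"
    and f: "\<forall>\<^sub>F x in nhds 0. f x = \<tau> (cubic d (\<sigma> x))"
    and ker: "frechet_derivative \<sigma> (at 0) (\<eta> 0) $ 2 = 0"
  shows "dir_deriv \<eta> (dir_deriv \<eta> (jac_det f)) 0 =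
    6 * (jac_det \<tau> 0 * jac_det \<sigma> 0) * (frechet_derivative \<sigma> (at 0) (\<eta> 0) $ 1)\<^sup>2"
proof -
  define u where "u p = jac_det \<tau> (cubic d (\<sigma> p)) * jac_det \<sigma> p" for p
  note D = smooth_germD
  note sg = smooth_germ_compose[OF smooth_germ_cubic assms(2)]
  have su: "smooth_near_0 u"
    unfolding u_def
    by (intro smooth_near_0_mult smooth_near_0_compose[OF smooth_near_0_jac_det D(1)[OF sg] D(2)[OF sg]]
        smooth_near_0_jac_det D(1) assms)
  have ss: "smooth_near_0 (\<lambda>x. \<sigma> x $ i)" for i
    by (intro smooth_near_0_nth D(1) assms)
  have s0: "\<sigma> 0 = 0" "u 0 = jac_det \<tau> 0 * jac_det \<sigma> 0"
    using D(2)[OF assms(2)] D(2)[OF sg] by (auto simp: u_def)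
  have sc: "smooth_near_0 (\<lambda>x. c * u x * \<sigma> x $ i)" for c i
    by (intro smooth_near_0_mult su ss smooth_near_0_const)
  have dd: "dir_deriv \<eta> (\<lambda>x. c * u x * \<sigma> x $ i) 0 = c * u 0 * frechet_derivative \<sigma> (at 0) (\<eta> 0) $ i" for c i
    using s0(1) by (simp add: dir_deriv_mult dir_deriv_nth smooth_near_0_differentiable_0 su ss
        smooth_near_0_mult smooth_near_0_const D(1)[OF assms(2)])
  \<comment> \<open>Each summand is grouped as a product of two functions vanishing at 0, the unit
    \<open>u\<close> going into the first one.\<close>
  have "\<forall>\<^sub>F x in nhds 0. jac_det f x = (3 * u x * \<sigma> x $ 1) * \<sigma> x $ 1 + (d * u x * \<sigma> x $ 2) * \<sigma> x $ 2"
    using jac_det_compose3[OF assms(1) smooth_germ_cubic assms(2) f]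
    by eventually_elim (simp add: u_def jac_det_cubic power2_eq_square algebra_simps)
  then have "dir_deriv \<eta> (dir_deriv \<eta> (jac_det f)) 0 = dir_deriv \<eta> (dir_deriv \<eta>
      (\<lambda>x. (3 * u x * \<sigma> x $ 1) * \<sigma> x $ 1 + (d * u x * \<sigma> x $ 2) * \<sigma> x $ 2)) 0"
    by (intro dir_deriv_cong_ev ev_dir_deriv_cong)
  also have "\<dots> = dir_deriv \<eta> (\<lambda>p. dir_deriv \<eta> (\<lambda>x. (3 * u x * \<sigma> x $ 1) * \<sigma> x $ 1) p
      + dir_deriv \<eta> (\<lambda>x. (d * u x * \<sigma> x $ 2) * \<sigma> x $ 2) p) 0"
  proof (rule dir_deriv_cong_ev)
    have "\<forall>\<^sub>F p in nhds 0. (\<lambda>x. (3 * u x * \<sigma> x $ 1) * \<sigma> x $ 1) differentiable (at p)"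
      "\<forall>\<^sub>F p in nhds 0. (\<lambda>x. (d * u x * \<sigma> x $ 2) * \<sigma> x $ 2) differentiable (at p)"
      by (rule smooth_near_0_differentiable[OF smooth_near_0_mult[OF sc ss]])+
    then show "\<forall>\<^sub>F p in nhds 0. dir_deriv \<eta>
        (\<lambda>x. (3 * u x * \<sigma> x $ 1) * \<sigma> x $ 1 + (d * u x * \<sigma> x $ 2) * \<sigma> x $ 2) p =
       dir_deriv \<eta> (\<lambda>x. (3 * u x * \<sigma> x $ 1) * \<sigma> x $ 1) p
      + dir_deriv \<eta> (\<lambda>x. (d * u x * \<sigma> x $ 2) * \<sigma> x $ 2) p"
      by eventually_elim (rule dir_deriv_add)
  qed
  also have "\<dots> = dir_deriv \<eta> (dir_deriv \<eta> (\<lambda>x. (3 * u x * \<sigma> x $ 1) * \<sigma> x $ 1)) 0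
      + dir_deriv \<eta> (dir_deriv \<eta> (\<lambda>x. (d * u x * \<sigma> x $ 2) * \<sigma> x $ 2)) 0"
    by (intro dir_deriv_add smooth_near_0_differentiable_0 smooth_near_0_dir_deriv assms
        smooth_near_0_mult[OF sc ss])
  also have "\<dots> = 6 * u 0 * (frechet_derivative \<sigma> (at 0) (\<eta> 0) $ 1)\<^sup>2"
    by (simp add: dir_deriv2_mult_vanishing[OF assms(3) sc ss] s0(1) dd dir_deriv_nth D(1)[OF assms(2)]
        ker power2_eq_square)
  finally show ?thesis by (simp add: s0(2))
qed

text \<open>Since \<open>g\<close> keeps the second coordinate, \<sigma>_2 equals the second
  component of \<theta> o f, whose derivative vanishes on the kernel of df. The swallowtail needs
  this along the singular curve, hence at all points near 0.\<close>

lemma frechet_kernel_second_coordinate: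
  assumes "smooth_germ f" "smooth_germ \<sigma>" "smooth_germ \<theta>" "\<And>y. g y $ 2 = y $ 2"
    and "\<forall>\<^sub>F x in nhds 0. \<theta> (f x) = g (\<sigma> x)"
  shows "\<forall>\<^sub>F p in nhds (0::real^2). \<forall>v. frechet_derivative f (at p) v = 0 \<longrightarrow>
    frechet_derivative \<sigma> (at p) v $ (2::2) = (0::real)"
  using ev_ev[OF assms(5)] smooth_germ_differentiable_compose[OF assms(3,1)]
    smooth_near_0_differentiable[OF smooth_germD(1)[OF assms(1)]]
    smooth_near_0_differentiable[OF smooth_germD(1)[OF assms(2)]]
    smooth_near_0_differentiable[OF smooth_germD(1)[OF smooth_germ_compose[OF assms(3,1)]]]
proof eventually_elim
  case (elim p)
  show ?case
  proof (intro allI impI)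
    fix v assume v: "frechet_derivative f (at p) v = 0"
    have "\<forall>\<^sub>F x in nhds p. \<sigma> x $ 2 = \<theta> (f x) $ 2"
      using elim(1) by eventually_elim (simp add: assms(4))
    from frechet_derivative_cong_ev[OF this]
    have "frechet_derivative \<sigma> (at p) v $ 2 = frechet_derivative (\<lambda>x. \<theta> (f x)) (at p) v $ 2"
      by (simp add: frechet_derivative_nth[OF elim(4), symmetric] frechet_derivative_nth[OF elim(5), symmetric])
    also have "\<dots> = 0"
      by (simp add: frechet_derivative_chain[OF elim(3,2)] v linear_0[OF linear_frechet_derivative[OF elim(2)]])
    finally show "frechet_derivative \<sigma> (at p) v $ 2 = 0" .
  qed
qed

lemma diffeo_frechet_nonzero:
  assumes "diffeo_germ \<sigma>" "v \<noteq> 0" shows "frechet_derivative \<sigma> (at 0) v \<noteq> 0"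
proof
  assume v: "frechet_derivative \<sigma> (at 0) v = 0"
  obtain \<kappa> where k: "diffeo_germ \<kappa>" "\<forall>\<^sub>F x in nhds 0. \<kappa> (\<sigma> x) = x"
    using assms(1) by (rule diffeo_germ_inverse)
  have d: "\<sigma> differentiable (at 0)" "\<kappa> differentiable (at (\<sigma> 0))"
    using diffeo_germ_smooth[OF k(1)] diffeo_germ_smooth[OF assms(1)]
    by (auto simp: smooth_germD smooth_near_0_differentiable_0)
  have "v = frechet_derivative (\<lambda>x. \<kappa> (\<sigma> x)) (at 0) v"
    using frechet_derivative_cong_ev[OF k(2)] by (simp add: frechet_derivative_ident)
  also have "\<dots> = 0"
    by (simp add: frechet_derivative_chain[OF d] v linear_0[OF linear_frechet_derivative[OF d(2)]])
  finally show False using assms(2) by simp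
qed

lemma A_equivalent_factors:
  assumes "smooth_germ f" "A_equivalent f g"
  obtains \<sigma> \<tau> \<sigma>' \<tau>' where
    "diffeo_germ \<sigma>" "diffeo_germ \<tau>" "diffeo_germ \<sigma>'" "diffeo_germ \<tau>'"
    "\<forall>\<^sub>F x in nhds 0. g x = \<tau>' (f (\<sigma>' x))"
    "\<forall>\<^sub>F x in nhds 0. f x = \<tau> (g (\<sigma> x))"
    "\<forall>\<^sub>F x in nhds 0. \<tau>' (f x) = g (\<sigma> x)"
    "\<forall>\<^sub>F x in nhds 0. \<sigma> (\<sigma>' x) = x" "\<forall>\<^sub>F x in nhds 0. \<sigma>' (\<sigma> x) = x"
    "\<forall>\<^sub>F x in nhds 0. \<tau> (\<tau>' x) = x" "\<forall>\<^sub>F x in nhds 0. \<tau>' (\<tau> x) = x"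
proof -
  obtain \<sigma>' \<tau>' where st: "diffeo_germ \<sigma>'" "diffeo_germ \<tau>'" "\<forall>\<^sub>F x in nhds 0. g x = \<tau>' (f (\<sigma>' x))"
    using assms(2) by (auto simp: A_equivalent_def)
  obtain \<sigma> where s: "diffeo_germ \<sigma>" "\<forall>\<^sub>F x in nhds 0. \<sigma> (\<sigma>' x) = x" "\<forall>\<^sub>F x in nhds 0. \<sigma>' (\<sigma> x) = x"
    by (rule diffeo_germ_inverse[OF st(1)])
  obtain \<tau> where t: "diffeo_germ \<tau>" "\<forall>\<^sub>F x in nhds 0. \<tau> (\<tau>' x) = x" "\<forall>\<^sub>F x in nhds 0. \<tau>' (\<tau> x) = x"
    by (rule diffeo_germ_inverse[OF st(2)])
  have 1: "\<forall>\<^sub>F x in nhds 0. \<tau>' (f x) = g (\<sigma> x)"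
    using smooth_germ_ev_compose[OF st(3) diffeo_germ_smooth[OF s(1)]] s(3) by eventually_elim simp
  have "\<forall>\<^sub>F x in nhds 0. f x = \<tau> (g (\<sigma> x))"
    using 1 smooth_germ_ev_compose[OF t(2) assms(1)] by eventually_elim metis
  then show ?thesis using that st s t 1 by blast
qed

lemma jac_det_diffeo_compose:
  assumes "smooth_germ f" "smooth_germ g"
  shows "jac_det (\<lambda>x. f (g x)) 0 = jac_det f 0 * jac_det g 0"
  using assms jac_det_compose[of g 0 f] by (simp add: smooth_germD smooth_near_0_differentiable_0)

lemma null_fieldD:
  assumes "null_field f \<eta>"
  shows "smooth_near_0 \<eta>" "\<eta> 0 \<noteq> 0"
    "\<forall>\<^sub>F p in nhds 0. jac_det f p = 0 \<longrightarrow> frechet_derivative f (at p) (\<eta> p) = 0"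
  using assms unfolding null_field_def smooth_near_0_def eventually_nhds by blast+

text \<open>For \<open>a = -1\<close> this symmetry reverses the source and target orientations
  together, so it can repair one of them while the product of the two signs is unchanged.\<close>

lemma cubic_dmat: "a \<in> {1, -1} \<Longrightarrow> cubic d x = dmat a 1 *v cubic d (dmat a 1 *v x)"
  by (auto simp: cubic_def dmat_mult vec_eq_iff forall_2)

lemma cubic_isotopic:
  assumes f: "smooth_germ f" "A_equivalent f (cubic d)" "r_determined r f" "null_field f \<eta>"
    and "\<epsilon> \<in> {1, -1}" "sgn (dir_deriv \<eta> (dir_deriv \<eta> (jac_det f)) 0) = \<epsilon>"
  shows "A_isotopic r f (\<lambda>x. dmat \<epsilon> 1 *v cubic d x)"
proof -
  obtain \<sigma> \<tau> \<sigma>' \<tau>' where *: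
    "diffeo_germ \<sigma>" "diffeo_germ \<tau>" "diffeo_germ \<sigma>'" "diffeo_germ \<tau>'"
    "\<forall>\<^sub>F x in nhds 0. cubic d x = \<tau>' (f (\<sigma>' x))"
    "\<forall>\<^sub>F x in nhds 0. f x = \<tau> (cubic d (\<sigma> x))"
    "\<forall>\<^sub>F x in nhds 0. \<tau>' (f x) = cubic d (\<sigma> x)"
    "\<forall>\<^sub>F x in nhds 0. \<sigma> (\<sigma>' x) = x" "\<forall>\<^sub>F x in nhds 0. \<sigma>' (\<sigma> x) = x"
    "\<forall>\<^sub>F x in nhds 0. \<tau> (\<tau>' x) = x" "\<forall>\<^sub>F x in nhds 0. \<tau>' (\<tau> x) = x"
    by (rule A_equivalent_factors[OF f(1,2)])
  note G = *(1-4)[THEN diffeo_germ_smooth]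
  have f0: "jac_det f 0 = 0"
    using eventually_nhds_x_imp_x[OF jac_det_compose3[OF G(2) smooth_germ_cubic G(1) *(6)]] G(1)
    by (simp add: jac_det_cubic smooth_germD)
  have "frechet_derivative f (at 0) (\<eta> 0) = 0"
    using eventually_nhds_x_imp_x[OF null_fieldD(3)[OF f(4)]] f0 by simp
  then have k2: "frechet_derivative \<sigma> (at 0) (\<eta> 0) $ 2 = 0"
    using eventually_nhds_x_imp_x[OF frechet_kernel_second_coordinate[OF f(1) G(1,4) _ *(7)]]
    by (simp add: cubic_def)
  have "frechet_derivative \<sigma> (at 0) (\<eta> 0) \<noteq> 0"
    using diffeo_frechet_nonzero[OF *(1) null_fieldD(2)[OF f(4)]] .
  then have k1: "frechet_derivative \<sigma> (at 0) (\<eta> 0) $ 1 \<noteq> 0"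
    using k2 by (auto simp: vec_eq_iff forall_2)
  have inv: "jac_det \<sigma> 0 * jac_det \<sigma>' 0 = 1" "jac_det \<tau> 0 * jac_det \<tau>' 0 = 1"
    by (rule jac_det_diffeo_inverse[OF G(3,1) *(8)], rule jac_det_diffeo_inverse[OF G(4,2) *(10)])
  have "(sgn (frechet_derivative \<sigma> (at 0) (\<eta> 0) $ 1))\<^sup>2 = 1"
    using k1 by (simp add: sgn_if)
  then have sgn: "sgn (jac_det \<tau> 0) * sgn (jac_det \<sigma> 0) = \<epsilon>"
    using cubic_hessian[OF G(2,1) null_fieldD(1)[OF f(4)] *(6) k2] assms(6)
    by (simp add: sgn_mult)
  \<comment> \<open>The reflection \<open>dmat a 1\<close> makes the source change positive. The
    symmetry of \<open>cubic d\<close> puts the same reflection into the target, where together with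
    the sign of the normal form it becomes \<open>\<epsilon> * a\<close>; the sign of the second
    derivative says precisely that this makes the target change positive.\<close>
  define a where "a = sgn (jac_det \<sigma>' 0)"
  have s: "sgn (jac_det \<sigma> 0) = a" "sgn (jac_det \<tau> 0) = sgn (jac_det \<tau>' 0)"
    using inv by (smt (verit) a_def mult_neg_pos sgn_if mult_pos_neg mult_eq_0_iff)+
  have a: "a \<in> {1, -1}" "a * jac_det \<sigma>' 0 > 0"
    using inv(1) unfolding a_def sgn_if by auto
  have ae: "\<epsilon> * a * jac_det \<tau>' 0 > 0"
    using sgn s inv(2) a(1) unfolding sgn_if by (auto split: if_splits)
  show ?thesis
  proof (rule A_isotopicI[OF f(3)])
    have da: "diffeo_germ (\<lambda>x. dmat a 1 *v x)" "diffeo_germ (\<lambda>x. dmat (\<epsilon> * a) 1 *v x)"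
      using a assms(5) by (auto intro!: diffeo_germ_matrix simp: det_dmat)
    show "diffeo_germ (\<lambda>x. \<sigma>' (dmat a 1 *v x))" "diffeo_germ (\<lambda>x. dmat (\<epsilon> * a) 1 *v \<tau>' x)"
      using diffeo_germ_compose[OF *(3) da(1)] diffeo_germ_compose[OF da(2) *(4)] by auto
    show "jac_det (\<lambda>x. \<sigma>' (dmat a 1 *v x)) 0 > 0"
      using jac_det_diffeo_compose[OF G(3) smooth_germ_matrix] a
      by (simp add: jac_det_matrix det_dmat mult.commute)
    show "jac_det (\<lambda>x. dmat (\<epsilon> * a) 1 *v \<tau>' x) 0 > 0"
      using jac_det_diffeo_compose[OF smooth_germ_matrix G(4)] ae
      by (simp add: jac_det_matrix det_dmat)
    have m: "dmat \<epsilon> 1 *v (dmat a 1 *v y) = dmat (\<epsilon> * a) 1 *v y" for y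
      by (simp add: dmat_mult mult.assoc)
    show "\<forall>\<^sub>F x in nhds 0. dmat \<epsilon> 1 *v cubic d x = dmat (\<epsilon> * a) 1 *v \<tau>' (f (\<sigma>' (dmat a 1 *v x)))"
      using smooth_germ_ev_compose[OF *(5) smooth_germ_matrix[of "dmat a 1"]]
      by eventually_elim (metis m cubic_dmat[OF a(1)])
  qed
qed

text \<open>Coordinate changes fixing 0 carry the zero fibre to the zero fibre. Here one fibre is an
  isolated point and the other contains a line.\<close>

lemma not_A_equivalent_fibre:
  fixes g h :: "real^2 \<Rightarrow> real^2"
  assumes "smooth_germ g" "\<And>x. g x = 0 \<Longrightarrow> x = 0" "\<And>s. h (s *\<^sub>R axis 1 1) = 0"
  shows "\<not> A_equivalent g h"
proof
  assume "A_equivalent g h"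
  then obtain \<sigma> \<tau> \<sigma>' \<tau>' where *:
    "diffeo_germ \<sigma>" "diffeo_germ \<tau>" "diffeo_germ \<sigma>'" "diffeo_germ \<tau>'"
    "\<forall>\<^sub>F x in nhds 0. h x = \<tau>' (g (\<sigma>' x))"
    "\<forall>\<^sub>F x in nhds 0. g x = \<tau> (h (\<sigma> x))"
    "\<forall>\<^sub>F x in nhds 0. \<tau>' (g x) = h (\<sigma> x)"
    "\<forall>\<^sub>F x in nhds 0. \<sigma> (\<sigma>' x) = x" "\<forall>\<^sub>F x in nhds 0. \<sigma>' (\<sigma> x) = x"
    "\<forall>\<^sub>F x in nhds 0. \<tau> (\<tau>' x) = x" "\<forall>\<^sub>F x in nhds 0. \<tau>' (\<tau> x) = x"
    by (rule A_equivalent_factors[OF assms(1)])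
  note G = *(1-4)[THEN diffeo_germ_smooth]
  have "\<forall>\<^sub>F x in nhds 0. h x = 0 \<longrightarrow> x = 0"
    using smooth_germ_ev_compose[OF *(10) smooth_germ_compose[OF assms(1) G(3)]] *(5,8)
    by eventually_elim (metis assms(2) smooth_germD(2)[OF G(2)] smooth_germD(2)[OF G(1)])
  then have "\<forall>\<^sub>F s in nhds (0::real). h (s *\<^sub>R axis 1 1) = 0 \<longrightarrow> s *\<^sub>R axis 1 1 = (0::real^2)"
    by (rule ev_compose) (auto intro!: continuous_intros)
  then have "\<forall>\<^sub>F s in nhds (0::real). s = 0"
    by eventually_elim (use assms(3) in \<open>simp add: axis_eq_0_iff\<close>)
  then have "\<forall>\<^sub>F s in at (0::real). False"
    unfolding eventually_at_filter by eventually_elim simp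
  then show False by simp
qed

text \<open>A factor vanishing at 0 raises the order of vanishing by one. Iterated, this shows that
  a monomial of degree n has zero jet of order n - 1.\<close>

lemma jet_eq_mult_zero:
  fixes a b :: "'a::euclidean_space \<Rightarrow> real"
  assumes "smooth_near_0 a" "smooth_near_0 b" "a 0 = 0" "jet_eq k b (\<lambda>x. 0)"
  shows "jet_eq (Suc k) (\<lambda>x. a x * b x) (\<lambda>x. 0)"
  using assms(2,4)
proof (induction k arbitrary: b)
  case (0 b)
  have D: "\<forall>\<^sub>F x in nhds 0. ((\<lambda>x. a x * b x) has_derivative
     (\<lambda>v. a x * frechet_derivative b (at x) v + frechet_derivative a (at x) v * b x)) (at x)"
    using smooth_near_0_has_derivative[OF assms(1)] smooth_near_0_has_derivative[OF 0(1)]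
    by eventually_elim (rule has_derivative_mult)
  show ?case
    by (rule jet_eq_SucI[where g' = "\<lambda>x v. 0", OF _ D]) (use 0 assms(3) in \<open>auto simp: jet_eq_0\<close>)
next
  case (Suc k b)
  have D: "\<forall>\<^sub>F x in nhds 0. ((\<lambda>x. a x * b x) has_derivative
     (\<lambda>v. a x * frechet_derivative b (at x) v + frechet_derivative a (at x) v * b x)) (at x)"
    using smooth_near_0_has_derivative[OF assms(1)] smooth_near_0_has_derivative[OF Suc.prems(1)]
    by eventually_elim (rule has_derivative_mult)
  show ?case
  proof (rule jet_eq_SucI[where g' = "\<lambda>x v. 0", OF _ D])
    fix c :: 'a assume c: "c \<in> Basis"
    have "jet_eq k (\<lambda>x. frechet_derivative b (at x) c) (\<lambda>x. 0)"
      using jet_eq_deriv[OF Suc.prems(2) c] by simp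
    \<comment> \<open>In the product rule this term keeps the vanishing factor \<open>a\<close>
      while the order of \<open>b\<close> drops by one, which is the induction hypothesis; the other
      term loses \<open>a\<close> but keeps \<open>b\<close> at full order.\<close>
    then have 1: "jet_eq (Suc k) (\<lambda>x. a x * frechet_derivative b (at x) c) (\<lambda>x. 0)"
      by (intro Suc.IH smooth_near_0_deriv Suc.prems)
    have 2: "jet_eq (Suc k) (\<lambda>x. frechet_derivative a (at x) c * b x) (\<lambda>x. frechet_derivative a (at x) c * 0)"
      by (intro jet_eq_mult smooth_near_0_deriv smooth_near_0_const Suc.prems assms(1) jet_eq_refl)
    show "jet_eq (Suc k) (\<lambda>x. a x * frechet_derivative b (at x) c + frechet_derivative a (at x) c * b x) (\<lambda>x. 0)"
      using jet_eq_add[OF _ _ _ _ 1 2]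
      by (simp add: smooth_near_0_mult smooth_near_0_deriv smooth_near_0_const Suc.prems assms(1))
  qed (use assms(3) in auto)
qed

lemma jet_eq_vector_2:
  assumes "smooth_near_0 a" "smooth_near_0 a'" "smooth_near_0 b" "jet_eq k a a'"
  shows "jet_eq k (\<lambda>x. vector [a x, b x] :: real^2) (\<lambda>x. vector [a' x, b x])"
  unfolding vector_2_decomp
  by (intro jet_eq_add jet_eq_scaleR smooth_near_0_scaleR smooth_near_0_const assms jet_eq_refl)

lemma smooth_coord: "smooth_near_0 (\<lambda>x. x $ i)"
  by (intro smooth_near_0_nth smooth_near_0_ident)

section \<open>Order of determinacy and non-isotopy of the two cubic normal forms\<close>

lemma r_determined_cubic: "r_determined r (cubic d) \<Longrightarrow> r \<ge> 3"
proof (rule ccontr)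
  assume r: "r_determined r (cubic d)" "\<not> r \<ge> 3"
  define h :: "real^2 \<Rightarrow> real^2" where "h x = vector [0, x $ 2]" for x
  have sh: "smooth_germ h"
    by (simp add: smooth_germ_def h_def[abs_def] vector_2_zero smooth_near_0_vector_2
        smooth_near_0_const smooth_coord)
  \<comment> \<open>The first component of \<open>cubic d\<close> is written as \<open>x$1\<close>
    times a form whose summands are products of two coordinates, so that its 2-jet is found by
    successive multiplication with vanishing factors.\<close>
  let ?q = "\<lambda>x::real^2. x$1 * x$1 + x$2 * (d * x$2)"
  have sc: "smooth_near_0 (\<lambda>x::real^2. d * x $ 2)"
    by (intro smooth_near_0_mult smooth_near_0_const smooth_coord)
  have "jet_eq 1 ?q (\<lambda>x. 0 + 0)"
    by (intro jet_eq_add smooth_near_0_mult smooth_coord sc smooth_near_0_const)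
      (simp_all add: jet_eq_mult_zero[of _ _ 0, simplified] smooth_coord sc jet_eq_0)
  then have "jet_eq (Suc 1) (\<lambda>x. x$1 * ?q x) (\<lambda>x. 0)"
    by (intro jet_eq_mult_zero smooth_near_0_add smooth_near_0_mult smooth_coord sc) simp_all
  then have "jet_eq 2 (\<lambda>x. vector [x$1 * ?q x, x$2]) h"
    unfolding h_def[abs_def]
    by (intro jet_eq_vector_2 smooth_near_0_add smooth_near_0_mult smooth_coord sc smooth_near_0_const)
      (simp add: numeral_2_eq_2)
  moreover have "(\<lambda>x. vector [x$1 * ?q x, x$2]) = cubic d"
    by (simp add: fun_eq_iff cubic_def power2_eq_square power3_eq_cube algebra_simps)
  ultimately have "jet_eq r h (cubic d)" using r(2) jet_eq_mono jet_eq_sym by fastforce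
  then have "A_equivalent (cubic d) h"
    using r(1) sh by (simp add: r_determined_def jet_eq_iff)
  moreover have "\<not> A_equivalent (cubic d) h"
    by (rule not_A_equivalent_fibre[OF smooth_germ_cubic])
      (auto simp: cubic_def h_def vec_eq_iff forall_2 axis_def)
  ultimately show False by blast
qed

lemma frechet_matrix_comp:
  fixes A :: "real^'n^'m"
  assumes "f differentiable (at x)"
  shows "frechet_derivative (\<lambda>x. A *v f x) (at x) v = A *v frechet_derivative f (at x) v"
proof -
  have "((\<lambda>x. A *v f x) has_derivative (\<lambda>v. A *v frechet_derivative f (at x) v)) (at x)"
    by (rule bounded_linear.has_derivative[OF matrix_vector_mul_bounded_linear])
      (use assms in \<open>simp add: frechet_derivative_works\<close>)
  then show ?thesis by (rule frechet_derivative_eqI)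
qed

lemma frechet_eq_jet_eq:
  assumes "jet_eq r f g" "r \<ge> 1" "b \<in> Basis"
  shows "frechet_derivative f (at 0) b = frechet_derivative g (at 0) b"
proof -
  have "jet_eq 1 f g" using assms jet_eq_mono by blast
  then show ?thesis using assms(3) by (simp add: jet_eq_Suc jet_eq_0)
qed

text \<open>The kernel lemma for the composite itself, with the inverse of \<open>\<psi>\<close> as
  target map. Germs with the same 1-jet have the same kernel at 0, so it locates the image under
  d\<phi> of the kernel of the other normal form.\<close>

lemma isotopic_kernel:
  assumes "smooth_germ \<phi>" "diffeo_germ \<psi>" "smooth_germ g" "\<And>y. g y $ 2 = y $ 2"
    and "frechet_derivative (\<lambda>x. \<psi> (g (\<phi> x))) (at 0) v = 0"
  shows "frechet_derivative \<phi> (at (0::real^2)) v $ (2::2) = (0::real)"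
proof -
  obtain \<psi>' where p: "diffeo_germ \<psi>'" "\<forall>\<^sub>F x in nhds 0. \<psi>' (\<psi> x) = x"
    using assms(2) by (rule diffeo_germ_inverse)
  have sg: "smooth_germ (\<lambda>x. g (\<phi> x))" using smooth_germ_compose[OF assms(3,1)] .
  have sh: "smooth_germ (\<lambda>x. \<psi> (g (\<phi> x)))"
    using smooth_germ_compose[OF diffeo_germ_smooth[OF assms(2)] sg] .
  have "\<forall>\<^sub>F x in nhds 0. \<psi>' (\<psi> (g (\<phi> x))) = g (\<phi> x)"
    using smooth_germ_ev_compose[OF p(2) sg] .
  from eventually_nhds_x_imp_x[OF frechet_kernel_second_coordinate[OF sh assms(1)
      diffeo_germ_smooth[OF p(1)] assms(4) this]] assms(5)
  show ?thesis by blast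
qed

text \<open>The second derivative of \<lambda> along the constant field e_1 is -6 for one germ and,
  by positivity of both determinants, nonnegative for any germ obtained from the other by
  orientation-preserving changes; equal 3-jets would make the two values agree.\<close>

lemma cubic_not_isotopic: "\<not> A_isotopic r (cubic d) (\<lambda>x. dmat (-1) 1 *v cubic d x)"
proof
  let ?g = "\<lambda>x. dmat (-1) 1 *v cubic d x" and ?e = "axis 1 1 :: real^2"
  assume iso: "A_isotopic r (cubic d) ?g"
  then have r: "r \<ge> 3" using r_determined_cubic unfolding A_isotopic_def by blast
  obtain \<phi> \<psi> where *: "diffeo_germ \<phi>" "diffeo_germ \<psi>" "jac_det \<phi> 0 > 0" "jac_det \<psi> 0 > 0"
    "jet_eq r ?g (\<lambda>x. \<psi> (cubic d (\<phi> x)))"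
    using A_isotopicD[OF iso] r by auto
  let ?h = "\<lambda>x. \<psi> (cubic d (\<phi> x))"
  note G = *(1,2)[THEN diffeo_germ_smooth]
  have sg: "smooth_germ ?g" using smooth_germ_compose[OF smooth_germ_matrix smooth_germ_cubic] .
  have sh: "smooth_germ ?h"
    using smooth_germ_compose[OF G(2) smooth_germ_compose[OF smooth_germ_cubic G(1)]] .
  have "frechet_derivative ?g (at 0) ?e = 0"
    by (subst frechet_matrix_comp)
      (simp_all add: smooth_near_0_differentiable_0 smooth_germD smooth_germ_cubic frechet_cubic dmat_mult
        axis_def vector_2_zero)
  then have "frechet_derivative ?h (at 0) ?e = 0"
    using frechet_eq_jet_eq[OF *(5)] r by simp
  then have k: "frechet_derivative \<phi> (at 0) ?e $ 2 = 0"
    by (intro isotopic_kernel[OF G(1) *(2) smooth_germ_cubic]) (simp_all add: cubic_def)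
  \<comment> \<open>Here \<open>r \<ge> 3\<close> enters: order 3 of the maps controls order 2 of
    their Jacobian determinants.\<close>
  have "jet_eq 2 (jac_det ?g) (jac_det ?h)"
    using jet_eq_jac_det[of ?g ?h 2] sg sh jet_eq_mono[OF *(5)] r
    by (simp add: smooth_germD numeral_3_eq_3 numeral_2_eq_2)
  from this[unfolded jet_eq_def, rule_format, of "[?e, ?e]"]
  have "iter_deriv [?e, ?e] (jac_det ?g) 0 = iter_deriv [?e, ?e] (jac_det ?h) 0"
    by (simp del: iter_deriv.simps)
  then have "dir_deriv (\<lambda>_. ?e) (dir_deriv (\<lambda>_. ?e) (jac_det ?g)) 0 =
      dir_deriv (\<lambda>_. ?e) (dir_deriv (\<lambda>_. ?e) (jac_det ?h)) 0"
    by (simp add: dir_deriv_def[abs_def])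
  moreover have "dir_deriv (\<lambda>_. ?e) (dir_deriv (\<lambda>_. ?e) (jac_det ?g)) 0 = -6"
    using cubic_hessian[OF smooth_germ_matrix[of "dmat (-1) 1"] smooth_germ_id smooth_near_0_const[of ?e], of ?g d]
    by (simp add: frechet_derivative_ident axis_def jac_det_matrix det_dmat jac_det_id)
  moreover have "dir_deriv (\<lambda>_. ?e) (dir_deriv (\<lambda>_. ?e) (jac_det ?h)) 0 =
     6 * (jac_det \<psi> 0 * jac_det \<phi> 0) * (frechet_derivative \<phi> (at 0) ?e $ 1)\<^sup>2"
    by (rule cubic_hessian[OF G(2,1) smooth_near_0_const, where d = d]) (simp_all add: k)
  moreover have "\<dots> \<ge> 0" using *(3,4) by (intro mult_nonneg_nonneg) auto
  ultimately show False by simp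
qed

section \<open>The invariant of the swallowtail\<close>

lemma ev_axis:
  assumes "\<forall>\<^sub>F z in nhds (0::real^2). P z"
  shows "\<forall>\<^sub>F s in nhds (0::real). P (s *\<^sub>R axis 1 1)"
  by (rule ev_compose[OF assms]) (auto intro!: continuous_intros)

lemma frechet_derivative_axis:
  fixes A :: "real^2 \<Rightarrow> real"
  assumes "A differentiable (at (s *\<^sub>R axis 1 1))"
  shows "((\<lambda>s. A (s *\<^sub>R axis 1 1)) has_real_derivative
    frechet_derivative A (at (s *\<^sub>R axis 1 1)) (axis 1 1)) (at s)"
proof -
  have "((\<lambda>s::real. s *\<^sub>R (axis 1 1 :: real^2)) has_derivative (\<lambda>t. t *\<^sub>R axis 1 1)) (at s)"
    by (auto intro!: derivative_eq_intros)
  from diff_chain_at[OF this, of A "frechet_derivative A (at (s *\<^sub>R axis 1 1))"] assms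
  have "((\<lambda>s. A (s *\<^sub>R axis 1 1)) has_derivative
      (\<lambda>t. frechet_derivative A (at (s *\<^sub>R axis 1 1)) (t *\<^sub>R axis 1 1))) (at s)"
    by (simp add: frechet_derivative_works o_def)
  then show ?thesis
    using linear_scale[OF linear_frechet_derivative[OF assms]]
    by (simp add: has_field_derivative_def mult_commute_abs)
qed

text \<open>The functions may differ off the axis; the derivative along the axis depends only on
  their values on it.\<close>

lemma frechet_axis_cong:
  fixes A B :: "real^2 \<Rightarrow> real"
  assumes "smooth_near_0 A" "smooth_near_0 B"
    and "\<forall>\<^sub>F s in nhds (0::real). A (s *\<^sub>R axis 1 1) = B (s *\<^sub>R axis 1 1)"
  shows "\<forall>\<^sub>F s in nhds (0::real). frechet_derivative A (at (s *\<^sub>R axis 1 1)) (axis 1 1) =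
    frechet_derivative B (at (s *\<^sub>R axis 1 1)) (axis 1 1)"
  using ev_ev[OF assms(3)] ev_axis[OF smooth_near_0_differentiable[OF assms(1)]]
    ev_axis[OF smooth_near_0_differentiable[OF assms(2)]]
proof eventually_elim
  case (elim s)
  have "((\<lambda>s. A (s *\<^sub>R axis 1 1)) has_real_derivative
    frechet_derivative B (at (s *\<^sub>R axis 1 1)) (axis 1 1)) (at s)"
    using frechet_derivative_axis[OF elim(3)] DERIV_cong_ev[OF refl elim(1) refl] by blast
  then show ?case using DERIV_unique[OF frechet_derivative_axis[OF elim(2)]] by blast
qed

lemma frechet_mult:
  fixes a b :: "'a::real_normed_vector \<Rightarrow> real"
  assumes "a differentiable (at p)" "b differentiable (at p)"
  shows "frechet_derivative (\<lambda>x. a x * b x) (at p) v =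
    a p * frechet_derivative b (at p) v + frechet_derivative a (at p) v * b p"
  using assms unfolding frechet_derivative_works
  by (rule frechet_derivative_eqI[OF has_derivative_mult])

lemma frechet_coord: "frechet_derivative (\<lambda>x::real^'n. x $ i) (at p) v = v $ i"
  by (rule frechet_derivative_eqI[OF has_derivative_nth_id])

lemma coord_differentiable: "(\<lambda>x::real^'n. x $ i) differentiable (at p)"
  using has_derivative_nth_id differentiableI by blast

text \<open>The coordinates are \<open>z\<^sub>1 = \<sigma>\<^sub>1\<close> and \<open>z\<^sub>2 = \<sigma>\<^sub>2 + 4 \<sigma>\<^sub>1\<^sup>3\<close>, in which the singular set is \<open>z\<^sub>2 = 0\<close>. The last
  assumption expresses that the null field annihilates \<open>\<sigma>\<^sub>2\<close> there. Along \<open>z\<^sub>2 = 0\<close> it makes the first two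
  derivatives divisible by \<open>z\<^sub>1\<^sup>2\<close> and \<open>z\<^sub>1\<close>.\<close>

lemma dir_deriv3_swallowtail_normal_form:
  fixes U :: "real^2 \<Rightarrow> real"
  assumes eta: "smooth_near_0 \<eta>" and U: "smooth_near_0 U"
    and F: "smooth_near_0 F" "\<forall>\<^sub>F z in nhds 0. F z = U z * z $ 2"
    and ax: "\<forall>\<^sub>F s in nhds (0::real). \<eta> (s *\<^sub>R axis 1 1) $ 2 = 12 * s\<^sup>2 * \<eta> (s *\<^sub>R axis 1 1) $ 1"
  shows "dir_deriv \<eta> (dir_deriv \<eta> (dir_deriv \<eta> F)) 0 = 24 * (\<eta> 0 $ 1)^3 * U 0"
proof -
  define P where "P z = \<eta> z $ 1" for z
  define D where "D i (G :: real^2 \<Rightarrow> real) z = frechet_derivative G (at z) (axis i 1)" for i G z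
  let ?e = "axis 1 1 :: real^2"
  define G1 where "G1 = dir_deriv \<eta> F"
  define G2 where "G2 = dir_deriv \<eta> G1"
  note si = smooth_near_0_mult smooth_near_0_add smooth_near_0_const smooth_near_0_power smooth_coord
  have sP: "smooth_near_0 P" unfolding P_def by (intro smooth_near_0_nth eta)
  have s1: "smooth_near_0 G1" unfolding G1_def by (intro smooth_near_0_dir_deriv eta F)
  have s2: "smooth_near_0 G2" unfolding G2_def by (intro smooth_near_0_dir_deriv eta s1)
  have sD: "smooth_near_0 (D i G)" if "smooth_near_0 G" for i G
    unfolding D_def by (intro smooth_near_0_deriv that)
  have X: "dir_deriv \<eta> G z = P z * D 1 G z + \<eta> z $ 2 * D 2 G z" if "G differentiable (at z)" for G z
    unfolding P_def D_def using dir_deriv_eq_sum[OF that] .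
  have DF: "\<forall>\<^sub>F z in nhds 0. D i F z = U z * axis i 1 $ 2 + D i U z * z $ 2" for i
    using ev_ev[OF F(2)] smooth_near_0_differentiable[OF U]
  proof eventually_elim
    case (elim z)
    show ?case
      unfolding D_def frechet_derivative_cong_ev[OF elim(1)]
      by (simp add: frechet_mult[OF elim(2) coord_differentiable] frechet_coord)
  qed
  define PU where "PU z = P z * U z" for z
  have sPU: "smooth_near_0 PU" unfolding PU_def by (intro si sP U)
  \<comment> \<open>On \<open>z$2 = 0\<close> the form F = U z_2 gives \<open>D 1 F = 0\<close> and
    \<open>D 2 F = U\<close>, so there \<open>G1\<close> is \<eta>_2 U = 12 z_1^2 P U. The function
    \<open>E\<close> extends this expression off the axis.\<close>
  define E where "E z = (12 * (z$1)\<^sup>2) * PU z" for z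
  have sE: "smooth_near_0 E" unfolding E_def by (intro si sPU)
  have G1E: "\<forall>\<^sub>F s in nhds 0. G1 (s *\<^sub>R ?e) = E (s *\<^sub>R ?e)"
    using ax ev_axis[OF smooth_near_0_differentiable[OF F(1)]] ev_axis[OF DF[of 1]] ev_axis[OF DF[of 2]]
    by eventually_elim (simp add: G1_def X E_def PU_def P_def axis_def)
  have DE: "\<forall>\<^sub>F z in nhds 0. D 1 E z = 24 * z$1 * PU z + 12 * (z$1)\<^sup>2 * D 1 PU z"
    using smooth_near_0_differentiable[OF sPU]
  proof eventually_elim
    case (elim z)
    have d: "((\<lambda>z::real^2. 12 * (z$1)\<^sup>2) has_derivative (\<lambda>v. 24 * z$1 * v$1)) (at z)"
      by (auto intro!: derivative_eq_intros has_derivative_nth_id)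
    show ?case
      unfolding D_def E_def[abs_def]
      by (simp add: frechet_mult[OF differentiableI[OF d] elim] frechet_derivative_eqI[OF d] axis_def)
  qed
  \<comment> \<open>On the axis \<open>G2\<close> is P (D 1 G1) + \<eta>_2 (D 2 G1). The derivative
    \<open>D 2 G1\<close> across the axis is not computed, but it comes with \<eta>_2 = 12 z_1^2 P;
    hence one factor z_1 splits off from the whole and W(0) = 24 P(0)^2 U(0).\<close>
  define W where "W z = P z * (24 * PU z + (12 * z$1) * D 1 PU z) + (12 * z$1) * P z * D 2 G1 z" for z
  have sW: "smooth_near_0 W" unfolding W_def by (intro si sP sPU sD s1)
  have sW': "smooth_near_0 (\<lambda>z. z$1 * W z)" by (intro si sW)
  have "\<forall>\<^sub>F s in nhds 0. G2 (s *\<^sub>R ?e) = (s *\<^sub>R ?e)$1 * W (s *\<^sub>R ?e)"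
    using ax ev_axis[OF smooth_near_0_differentiable[OF s1]] frechet_axis_cong[OF s1 sE G1E] ev_axis[OF DE]
  proof eventually_elim
    case (elim s)
    have "D 1 G1 (s *\<^sub>R ?e) = D 1 E (s *\<^sub>R ?e)" using elim(3) by (simp add: D_def)
    moreover have "(s *\<^sub>R ?e) $ 1 = s" by (simp add: axis_def)
    ultimately show ?case
      using elim(1,4) unfolding G2_def X[OF elim(2)] W_def P_def
      by (simp add: power2_eq_square algebra_simps)
  qed
  from eventually_nhds_x_imp_x[OF frechet_axis_cong[OF s2 sW' this]]
  have "D 1 G2 0 = W 0"
    using frechet_mult[OF coord_differentiable smooth_near_0_differentiable_0[OF sW]]
    by (simp add: D_def frechet_coord axis_def)
  \<comment> \<open>The field points along the axis at 0, so the third derivative needs no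
    derivative of \<open>G2\<close> across the axis.\<close>
  moreover have "\<eta> 0 $ 2 = 0" using eventually_nhds_x_imp_x[OF ax] by simp
  ultimately have "dir_deriv \<eta> G2 0 = P 0 * W 0"
    by (simp add: X smooth_near_0_differentiable_0[OF s2])
  then show ?thesis
    by (simp add: G2_def G1_def W_def PU_def P_def power3_eq_cube)
qed

section \<open>Change of coordinates and the derivatives of \<lambda> for the swallowtail\<close>

lemma smooth_near_0_frechet_field:
  fixes S \<eta> :: "real^2 \<Rightarrow> real^2"
  assumes "smooth_near_0 S" "smooth_near_0 \<eta>"
  shows "smooth_near_0 (\<lambda>p. frechet_derivative S (at p) (\<eta> p))"
proof (rule smooth_near_0_cong_ev)
  show "\<forall>\<^sub>F p in nhds 0. frechet_derivative S (at p) (\<eta> p) =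
      (\<Sum>b\<in>Basis. (\<eta> p \<bullet> b) *\<^sub>R frechet_derivative S (at p) b)"
    using smooth_near_0_differentiable[OF assms(1)] by eventually_elim (rule frechet_derivative_basis)
qed (intro smooth_near_0_sum smooth_near_0_scaleR smooth_near_0_inner smooth_near_0_deriv assms finite_Basis)

text \<open>The chain rule for F = (F o \<kappa>) o S near \<kappa>(z); the field on the right is
  the push-forward of \<eta> under \<open>S\<close>. It holds on a neighbourhood and can thus be
  iterated.\<close>

lemma dir_deriv_transport:
  fixes S \<kappa> \<eta> :: "real^2 \<Rightarrow> real^2"
  assumes "smooth_germ S" "smooth_germ \<kappa>" "\<forall>\<^sub>F x in nhds 0. \<kappa> (S x) = x" "\<forall>\<^sub>F x in nhds 0. S (\<kappa> x) = x"
    and "smooth_near_0 F"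
  shows "\<forall>\<^sub>F z in nhds 0. dir_deriv \<eta> F (\<kappa> z) =
    dir_deriv (\<lambda>z. frechet_derivative S (at (\<kappa> z)) (\<eta> (\<kappa> z))) (\<lambda>z. F (\<kappa> z)) z"
  using smooth_germ_ev_compose[OF ev_ev[OF assms(3)] assms(2)] assms(4)
    smooth_germ_differentiable_compose[OF assms(1,2)]
    smooth_near_0_differentiable[OF smooth_near_0_compose[OF assms(5) smooth_germD[OF assms(2)]]]
proof eventually_elim
  case (elim z)
  have "\<forall>\<^sub>F x in nhds (\<kappa> z). F x = F (\<kappa> (S x))"
    using elim(1) by eventually_elim simp
  from frechet_derivative_cong_ev[OF this]
  show ?case
    unfolding dir_deriv_def
    using frechet_derivative_chain[of S "\<kappa> z" "\<lambda>z. F (\<kappa> z)"] elim(2-4) by simp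
qed

lemma dir_deriv3_transport:
  fixes S \<kappa> \<eta> :: "real^2 \<Rightarrow> real^2"
  assumes "smooth_germ S" "smooth_germ \<kappa>" "\<forall>\<^sub>F x in nhds 0. \<kappa> (S x) = x" "\<forall>\<^sub>F x in nhds 0. S (\<kappa> x) = x"
    and "smooth_near_0 F" "smooth_near_0 \<eta>"
  defines "\<zeta> \<equiv> \<lambda>z. frechet_derivative S (at (\<kappa> z)) (\<eta> (\<kappa> z))"
  shows "dir_deriv \<eta> (dir_deriv \<eta> (dir_deriv \<eta> F)) 0 =
    dir_deriv \<zeta> (dir_deriv \<zeta> (dir_deriv \<zeta> (\<lambda>z. F (\<kappa> z)))) 0"
proof -
  have T: "\<forall>\<^sub>F z in nhds 0. dir_deriv \<eta> G (\<kappa> z) = dir_deriv \<zeta> (\<lambda>z. G (\<kappa> z)) z"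
    if "smooth_near_0 G" for G
    unfolding \<zeta>_def by (rule dir_deriv_transport[OF assms(1-4) that])
  have s: "smooth_near_0 (dir_deriv \<eta> F)" "smooth_near_0 (dir_deriv \<eta> (dir_deriv \<eta> F))"
    by (intro smooth_near_0_dir_deriv assms)+
  have "dir_deriv \<eta> (dir_deriv \<eta> (dir_deriv \<eta> F)) 0 =
      dir_deriv \<zeta> (\<lambda>z. dir_deriv \<eta> (dir_deriv \<eta> F) (\<kappa> z)) 0"
    using eventually_nhds_x_imp_x[OF T[OF s(2)]] by (simp add: smooth_germD(2)[OF assms(2)])
  also have "\<dots> = dir_deriv \<zeta> (dir_deriv \<zeta> (\<lambda>z. dir_deriv \<eta> F (\<kappa> z))) 0"
    by (rule dir_deriv_cong_ev[OF T[OF s(1)]])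
  also have "\<dots> = dir_deriv \<zeta> (dir_deriv \<zeta> (dir_deriv \<zeta> (\<lambda>z. F (\<kappa> z)))) 0"
    by (rule dir_deriv_cong_ev[OF ev_dir_deriv_cong[OF T[OF assms(5)]]])
  finally show ?thesis .
qed

text \<open>For \<open>c = 4\<close> the second component is the Jacobian determinant of the
  swallowtail, so this coordinate change straightens its singular curve.\<close>

definition shear :: "real \<Rightarrow> real^2 \<Rightarrow> real^2" where
  "shear c y = vector [y$1, y$2 + c * (y$1)^3]"

lemma shear_shear: "shear (- c) (shear c y) = y"
  by (simp add: shear_def vec_eq_iff forall_2)

lemma smooth_germ_shear: "smooth_germ (shear c)"
  unfolding smooth_germ_def shear_def[abs_def]
  by (auto simp: vector_2_zero intro!: smooth_near_0_vector_2 smooth_near_0_add smooth_near_0_mult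
      smooth_near_0_power smooth_coord smooth_near_0_const)

lemma diffeo_germ_shear: "diffeo_germ (shear c)"
  unfolding diffeo_germ_def using smooth_germ_shear shear_shear[of c] shear_shear[of "- c"]
  by (intro conjI exI[of _ "shear (- c)"]) auto

lemma frechet_shear: "frechet_derivative (shear c) (at y) v = vector [v$1, v$2 + 3 * c * (y$1)\<^sup>2 * v$1]"
proof -
  have "((\<lambda>y. y$2 + c * (y$1)^3) has_derivative (\<lambda>v. v$2 + 3 * c * (y$1)\<^sup>2 * v$1)) (at y)"
    by (auto intro!: derivative_eq_intros has_derivative_nth_id simp: algebra_simps)
  from frechet_derivative_eqI[OF has_derivative_vector_2[OF has_derivative_nth_id this]]
  show ?thesis unfolding shear_def[abs_def] .
qed

text \<open>\<lambda> is u times the second component of \<open>shear 4\<close> composed with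
  \<sigma>. That component vanishes at 0, so u is not differentiated, and the derivative of the
  shear at 0 is the identity.\<close>

lemma swallowtail_xi:
  assumes "smooth_germ \<tau>" "smooth_germ \<sigma>"
    and f: "\<forall>\<^sub>F x in nhds 0. f x = \<tau> (swallowtail (\<sigma> x))"
  shows "dir_deriv \<xi> (jac_det f) 0 =
    jac_det \<tau> 0 * jac_det \<sigma> 0 * frechet_derivative \<sigma> (at 0) (\<xi> 0) $ 2"
proof -
  define u where "u p = jac_det \<tau> (swallowtail (\<sigma> p)) * jac_det \<sigma> p" for p
  note D = smooth_germD
  note sg = smooth_germ_compose[OF smooth_germ_swallowtail assms(2)]
  have su: "smooth_near_0 u"
    unfolding u_def
    by (intro smooth_near_0_mult smooth_near_0_compose[OF smooth_near_0_jac_det D(1)[OF sg] D(2)[OF sg]]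
        smooth_near_0_jac_det D(1) assms)
  have ss: "smooth_germ (\<lambda>x. shear 4 (\<sigma> x))"
    using smooth_germ_compose[OF smooth_germ_shear assms(2)] .
  have ss2: "smooth_near_0 (\<lambda>x. shear 4 (\<sigma> x) $ 2)"
    by (intro smooth_near_0_nth D(1) ss)
  have "\<forall>\<^sub>F x in nhds 0. jac_det f x = u x * shear 4 (\<sigma> x) $ 2"
    using jac_det_compose3[OF assms(1) smooth_germ_swallowtail assms(2) f]
    by eventually_elim (simp add: u_def jac_det_swallowtail shear_def)
  from dir_deriv_cong_ev[OF this]
  have "dir_deriv \<xi> (jac_det f) 0 = u 0 * frechet_derivative (\<lambda>x. shear 4 (\<sigma> x)) (at 0) (\<xi> 0) $ 2"
    using D(2)[OF ss]
    by (simp add: dir_deriv_mult dir_deriv_nth smooth_near_0_differentiable_0 su ss2 D(1)[OF ss])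
  also have "frechet_derivative (\<lambda>x. shear 4 (\<sigma> x)) (at 0) (\<xi> 0) =
      frechet_derivative (shear 4) (at (\<sigma> 0)) (frechet_derivative \<sigma> (at 0) (\<xi> 0))"
    by (rule frechet_derivative_chain)
      (simp_all add: D[OF assms(2)] D(1)[OF smooth_germ_shear] smooth_near_0_differentiable_0)
  finally show ?thesis
    using D(2)[OF assms(2)] D(2)[OF sg] by (simp add: frechet_shear u_def)
qed

text \<open>In the coordinates S = \<open>shear 4\<close> o \<sigma> the Jacobian determinant is a
  unit times z_2, which is the situation of \<open>dir_deriv3_swallowtail_normal_form\<close> for
  the pushed-forward field.\<close>

lemma swallowtail_eta3:
  assumes "smooth_germ f" "smooth_germ \<tau>" "diffeo_germ \<sigma>" "smooth_germ \<theta>"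
    and f: "\<forall>\<^sub>F x in nhds 0. f x = \<tau> (swallowtail (\<sigma> x))"
    and \<theta>: "\<forall>\<^sub>F x in nhds 0. \<theta> (f x) = swallowtail (\<sigma> x)"
    and null: "null_field f \<eta>"
  shows "dir_deriv \<eta> (dir_deriv \<eta> (dir_deriv \<eta> (jac_det f))) 0 =
      24 * (jac_det \<tau> 0 * jac_det \<sigma> 0) * (frechet_derivative \<sigma> (at 0) (\<eta> 0) $ 1)^3"
    and "frechet_derivative \<sigma> (at 0) (\<eta> 0) $ 2 = 0"
proof -
  note D = smooth_germD and N = null_fieldD[OF null]
  note s\<sigma> = diffeo_germ_smooth[OF assms(3)]
  define S where "S x = shear 4 (\<sigma> x)" for x
  have dS: "diffeo_germ S"
    unfolding S_def using diffeo_germ_compose[OF diffeo_germ_shear assms(3)] .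
  note sS = diffeo_germ_smooth[OF dS]
  obtain \<kappa> where k: "diffeo_germ \<kappa>" "\<forall>\<^sub>F x in nhds 0. \<kappa> (S x) = x" "\<forall>\<^sub>F x in nhds 0. S (\<kappa> x) = x"
    by (rule diffeo_germ_inverse[OF dS])
  note sk = diffeo_germ_smooth[OF k(1)]
  define u where "u p = jac_det \<tau> (swallowtail (\<sigma> p)) * jac_det \<sigma> p" for p
  note sg = smooth_germ_compose[OF smooth_germ_swallowtail s\<sigma>]
  have su: "smooth_near_0 u"
    unfolding u_def
    by (intro smooth_near_0_mult smooth_near_0_compose[OF smooth_near_0_jac_det D(1)[OF sg] D(2)[OF sg]]
        smooth_near_0_jac_det D(1) assms s\<sigma>)
  define \<zeta> where "\<zeta> z = frechet_derivative S (at (\<kappa> z)) (\<eta> (\<kappa> z))" for z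
  have s\<zeta>: "smooth_near_0 \<zeta>"
    unfolding \<zeta>_def
    using smooth_near_0_compose[OF smooth_near_0_frechet_field[OF D(1)[OF sS] N(1)] D[OF sk]] .
  have lam: "\<forall>\<^sub>F x in nhds 0. jac_det f x = u x * S x $ 2"
    using jac_det_compose3[OF assms(2) smooth_germ_swallowtail s\<sigma> f]
    by eventually_elim (simp add: u_def jac_det_swallowtail S_def shear_def)
  \<comment> \<open>The shear adds 12 \<sigma>_1^2 d\<sigma>_1 to d\<sigma>_2. On the singular curve
    d\<sigma>_2(\<eta>) = 0, which leaves the relation between the two components of
    \<open>\<zeta>\<close> along the axis.\<close>
  have DS: "\<forall>\<^sub>F p in nhds 0. \<forall>v. frechet_derivative S (at p) v =
      vector [frechet_derivative \<sigma> (at p) v $ 1,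
        frechet_derivative \<sigma> (at p) v $ 2 + 12 * (\<sigma> p $ 1)\<^sup>2 * frechet_derivative \<sigma> (at p) v $ 1]"
    using smooth_near_0_differentiable[OF D(1)[OF s\<sigma>]]
      smooth_germ_differentiable_compose[OF smooth_germ_shear s\<sigma>, of 4]
    unfolding S_def by eventually_elim (simp add: frechet_derivative_chain frechet_shear)
  have ker: "\<forall>\<^sub>F p in nhds 0. jac_det f p = 0 \<longrightarrow> frechet_derivative \<sigma> (at p) (\<eta> p) $ 2 = 0"
    using frechet_kernel_second_coordinate[OF assms(1) s\<sigma> assms(4) _ \<theta>] N(3)
    by (auto simp: swallowtail_def elim: eventually_elim2)
  have "\<forall>\<^sub>F z in nhds 0. z $ 2 = 0 \<longrightarrow> \<zeta> z $ 2 = 12 * (z$1)\<^sup>2 * \<zeta> z $ 1"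
    using smooth_germ_ev_compose[OF ker sk] smooth_germ_ev_compose[OF DS sk]
      smooth_germ_ev_compose[OF lam sk] k(3)
  proof eventually_elim
    case (elim z)
    have "S (\<kappa> z) $ 1 = z $ 1" using elim(4) by simp
    then have "\<sigma> (\<kappa> z) $ 1 = z $ 1" by (simp add: S_def shear_def)
    then show ?case using elim by (simp add: \<zeta>_def)
  qed
  from ev_axis[OF this]
  have ax: "\<forall>\<^sub>F s in nhds (0::real). \<zeta> (s *\<^sub>R axis 1 1) $ 2 = 12 * s\<^sup>2 * \<zeta> (s *\<^sub>R axis 1 1) $ 1"
    by (simp add: axis_def)
  have sJ: "smooth_near_0 (jac_det f)" by (intro smooth_near_0_jac_det D(1) assms)
  have FU: "\<forall>\<^sub>F z in nhds 0. jac_det f (\<kappa> z) = u (\<kappa> z) * z $ 2"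
    using smooth_germ_ev_compose[OF lam sk] k(3) by eventually_elim simp
  have "dir_deriv \<eta> (dir_deriv \<eta> (dir_deriv \<eta> (jac_det f))) 0 =
      dir_deriv \<zeta> (dir_deriv \<zeta> (dir_deriv \<zeta> (\<lambda>z. jac_det f (\<kappa> z)))) 0"
    using dir_deriv3_transport[OF sS sk k(2,3) sJ N(1)] unfolding \<zeta>_def .
  also have "\<dots> = 24 * (\<zeta> 0 $ 1)^3 * u (\<kappa> 0)"
    by (rule dir_deriv3_swallowtail_normal_form[OF s\<zeta> smooth_near_0_compose[OF su D[OF sk]]
        smooth_near_0_compose[OF sJ D[OF sk]] FU ax])
  also have "\<zeta> 0 $ 1 = frechet_derivative \<sigma> (at 0) (\<eta> 0) $ 1"
    using eventually_nhds_x_imp_x[OF DS] D(2)[OF sk] by (simp add: \<zeta>_def)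
  also have "u (\<kappa> 0) = jac_det \<tau> 0 * jac_det \<sigma> 0"
    using D(2)[OF sk] D(2)[OF sg] by (simp add: u_def)
  finally show "dir_deriv \<eta> (dir_deriv \<eta> (dir_deriv \<eta> (jac_det f))) 0 =
      24 * (jac_det \<tau> 0 * jac_det \<sigma> 0) * (frechet_derivative \<sigma> (at 0) (\<eta> 0) $ 1)^3" by simp
  have "jac_det f 0 = 0"
    using eventually_nhds_x_imp_x[OF lam] D(2)[OF sS] by simp
  then show "frechet_derivative \<sigma> (at 0) (\<eta> 0) $ 2 = 0"
    using eventually_nhds_x_imp_x[OF ker] by simp
qed

section \<open>Isotopy to the swallowtail normal form\<close>

lemma jac_det_frame:
  assumes "\<sigma> differentiable (at (p::real^2))"
  shows "jac_det \<sigma> p * det (vector [v, w] :: real^2^2) =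
    frechet_derivative \<sigma> (at p) v $ 1 * frechet_derivative \<sigma> (at p) w $ 2
    - frechet_derivative \<sigma> (at p) v $ 2 * frechet_derivative \<sigma> (at p) w $ 1"
proof -
  let ?D = "frechet_derivative \<sigma> (at p)"
  have lin: "linear ?D" using assms linear_frechet_derivative by blast
  have D: "?D x = x $ 1 *\<^sub>R ?D (axis 1 1) + x $ 2 *\<^sub>R ?D (axis 2 1)" for x
  proof -
    have "x = x $ 1 *\<^sub>R axis 1 1 + x $ 2 *\<^sub>R axis 2 1"
      by (simp add: vec_eq_iff forall_2 axis_def)
    then have "?D x = ?D (x $ 1 *\<^sub>R axis 1 1 + x $ 2 *\<^sub>R axis 2 1)" by simp
    then show ?thesis by (simp add: linear_add[OF lin] linear_scale[OF lin])
  qed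
  show ?thesis
    unfolding jac_det_formula det_2 D[of v] D[of w] by (simp add: algebra_simps)
qed

lemma swallowtail_sign_dmat: "e \<in> {1, -1} \<Longrightarrow> swallowtail_sign e x = swallowtail (dmat e 1 *v x)"
  by (auto simp: swallowtail_def swallowtail_sign_def dmat_mult vec_eq_iff forall_2)

text \<open>For \<open>b = -1\<close> the source is turned by a half-turn, which preserves
  orientation, and the target is reflected. The target orientation can thus be chosen freely, while
  the source orientation has to be absorbed in the sign of the normal form.\<close>

lemma swallowtail_sign_symmetric:
  "b \<in> {1, -1} \<Longrightarrow> swallowtail_sign e x = dmat 1 b *v swallowtail_sign e (dmat b b *v x)"
  by (auto simp: swallowtail_sign_def dmat_mult)

lemma swallowtail_isotopic:
  assumes f: "smooth_germ f" "A_equivalent f swallowtail" "r_determined r f" "null_field f \<eta>"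
    and fr: "positive_frame (\<eta> 0) (\<xi> 0)"
    and e: "\<epsilon> \<in> {1, -1}" "sgn (dir_deriv \<xi> (jac_det f) 0 *
                dir_deriv \<eta> (dir_deriv \<eta> (dir_deriv \<eta> (jac_det f))) 0) = \<epsilon>"
  shows "A_isotopic r f (swallowtail_sign \<epsilon>)"
proof -
  obtain \<sigma> \<tau> \<sigma>' \<tau>' where *:
    "diffeo_germ \<sigma>" "diffeo_germ \<tau>" "diffeo_germ \<sigma>'" "diffeo_germ \<tau>'"
    "\<forall>\<^sub>F x in nhds 0. swallowtail x = \<tau>' (f (\<sigma>' x))"
    "\<forall>\<^sub>F x in nhds 0. f x = \<tau> (swallowtail (\<sigma> x))"
    "\<forall>\<^sub>F x in nhds 0. \<tau>' (f x) = swallowtail (\<sigma> x)"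
    "\<forall>\<^sub>F x in nhds 0. \<sigma> (\<sigma>' x) = x" "\<forall>\<^sub>F x in nhds 0. \<sigma>' (\<sigma> x) = x"
    "\<forall>\<^sub>F x in nhds 0. \<tau> (\<tau>' x) = x" "\<forall>\<^sub>F x in nhds 0. \<tau>' (\<tau> x) = x"
    by (rule A_equivalent_factors[OF f(1,2)])
  note G = *(1-4)[THEN diffeo_germ_smooth]
  note eta = swallowtail_eta3[OF f(1) G(2) *(1) G(4) *(6,7) f(4)]
  note xi = swallowtail_xi[OF G(2,1) *(6), of \<xi>]
  let ?j = "jac_det \<sigma> 0" and ?\<rho> = "frechet_derivative \<sigma> (at 0) (\<eta> 0) $ 1"
    and ?x = "frechet_derivative \<sigma> (at 0) (\<xi> 0) $ 2" and ?u = "jac_det \<tau> 0 * jac_det \<sigma> 0"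
  have inv: "?j * jac_det \<sigma>' 0 = 1" "jac_det \<tau> 0 * jac_det \<tau>' 0 = 1"
    by (rule jac_det_diffeo_inverse[OF G(3,1) *(8)], rule jac_det_diffeo_inverse[OF G(4,2) *(10)])
  have fr': "?j * det (vector [\<eta> 0, \<xi> 0] :: real^2^2) = ?\<rho> * ?x"
    using jac_det_frame[OF smooth_near_0_differentiable_0[OF smooth_germD(1)[OF G(1)]], of "\<eta> 0" "\<xi> 0"]
      eta(2) by simp
  have dp: "det (vector [\<eta> 0, \<xi> 0] :: real^2^2) > 0"
    using fr by (simp add: positive_frame_def)
  have nz: "?u \<noteq> 0" "?\<rho> * ?x \<noteq> 0" using inv dp unfolding fr'[symmetric] by auto
  \<comment> \<open>The product is u x * 24 u \<rho>^3 = 24 (u \<rho>)^2 * \<rho> x, and \<rho> x is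
    det d\<sigma> times the determinant of the frame (\<eta>, \<xi>). Its sign for a positive frame
    is therefore that of det d\<sigma>; det d\<tau> enters squared.\<close>
  have "dir_deriv \<xi> (jac_det f) 0 * dir_deriv \<eta> (dir_deriv \<eta> (dir_deriv \<eta> (jac_det f))) 0
      = (24 * (?u * ?\<rho>)\<^sup>2) * (?j * det (vector [\<eta> 0, \<xi> 0] :: real^2^2))"
    unfolding eta(1) xi fr' by (simp add: power2_eq_square power3_eq_cube algebra_simps)
  moreover have "24 * (?u * ?\<rho>)\<^sup>2 > 0" using nz by simp
  ultimately have "\<epsilon> = sgn ?j" using e(2) dp by (simp only: sgn_mult sgn_pos mult_1 mult_1_right)
  then have es: "\<epsilon> * jac_det \<sigma>' 0 > 0"
    using inv(1) unfolding sgn_if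
    by (smt (verit) mult_minus_left mult_cancel_right1 mult_eq_0_iff mult_le_0_iff zero_less_mult_iff)
  define b where "b = sgn (jac_det \<tau>' 0)"
  have b: "b \<in> {1, -1}" "b * jac_det \<tau>' 0 > 0"
    using inv(2) unfolding b_def sgn_if by auto
  show ?thesis
  proof (rule A_isotopicI[OF f(3)])
    \<comment> \<open>The first factor turns the swallowtail into its form with sign \<epsilon>, the
      second is the half-turn or identity paired with the target correction \<open>dmat 1 b\<close>;
      its determinant b^2 = 1 leaves \<open>det ?A = \<epsilon>\<close>.\<close>
    let ?A = "dmat \<epsilon> 1 ** dmat b b"
    have dA: "det ?A = \<epsilon>" using b(1) by (auto simp: det_mul det_dmat)
    have da: "diffeo_germ (\<lambda>x. ?A *v x)" "diffeo_germ (\<lambda>x. dmat 1 b *v x)"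
      using b(1) e(1) dA by (auto intro!: diffeo_germ_matrix simp: det_dmat)
    show "diffeo_germ (\<lambda>x. \<sigma>' (?A *v x))" "diffeo_germ (\<lambda>x. dmat 1 b *v \<tau>' x)"
      using diffeo_germ_compose[OF *(3) da(1)] diffeo_germ_compose[OF da(2) *(4)] by auto
    show "jac_det (\<lambda>x. \<sigma>' (?A *v x)) 0 > 0"
      using jac_det_diffeo_compose[OF G(3) smooth_germ_matrix[of ?A]] es
      by (simp add: jac_det_matrix dA mult.commute)
    show "jac_det (\<lambda>x. dmat 1 b *v \<tau>' x) 0 > 0"
      using jac_det_diffeo_compose[OF smooth_germ_matrix G(4)] b
      by (simp add: jac_det_matrix det_dmat)
    show "\<forall>\<^sub>F x in nhds 0. swallowtail_sign \<epsilon> x = dmat 1 b *v \<tau>' (f (\<sigma>' (?A *v x)))"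
      using smooth_germ_ev_compose[OF *(5) smooth_germ_matrix[of ?A]]
    proof eventually_elim
      case (elim x)
      have "swallowtail_sign \<epsilon> x = dmat 1 b *v swallowtail (dmat \<epsilon> 1 *v (dmat b b *v x))"
        using swallowtail_sign_symmetric[OF b(1)] swallowtail_sign_dmat[OF e(1)] by metis
      then show ?case using elim by (simp add: matrix_vector_mul_assoc)
    qed
  qed
qed

section \<open>The two swallowtails are not isotopic\<close>

lemma r_determined_swallowtail_sign:
  assumes "r_determined r (swallowtail_sign e)" shows "r \<ge> 4"
proof (rule ccontr)
  assume r: "\<not> r \<ge> 4"
  define h :: "real^2 \<Rightarrow> real^2" where "h x = vector [e * x $ 1 * x $ 2, x $ 2]" for x
  note si = smooth_near_0_mult smooth_near_0_add smooth_near_0_const smooth_coord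
  have sh: "smooth_germ h"
    unfolding smooth_germ_def h_def[abs_def]
    by (auto simp: vector_2_zero intro!: smooth_near_0_vector_2 si)
  have sg: "smooth_germ (swallowtail_sign e)" using assms by (simp add: r_determined_def)
  \<comment> \<open>The dropped fourth power is written as nested products, so that
    \<open>jet_eq_mult_zero\<close> applied three times gives a zero 3-jet.\<close>
  let ?m = "\<lambda>x::real^2. x$1 * (x$1 * (x$1 * x$1))"
  have "jet_eq 0 (\<lambda>x::real^2. x$1) (\<lambda>x. 0)" by (simp add: jet_eq_0)
  then have "jet_eq (Suc (Suc (Suc 0))) ?m (\<lambda>x. 0)"
    by (intro jet_eq_mult_zero si) simp_all
  then have "jet_eq 3 (\<lambda>x. e * x$1 * x$2 + ?m x) (\<lambda>x. e * x$1 * x$2 + 0)"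
    by (intro jet_eq_add si jet_eq_refl) (simp add: numeral_3_eq_3)
  then have "jet_eq 3 (\<lambda>x. vector [e * x$1 * x$2 + ?m x, x$2]) h"
    unfolding h_def[abs_def] by (intro jet_eq_vector_2 si) simp
  moreover have "(\<lambda>x. vector [e * x$1 * x$2 + ?m x, x$2]) = swallowtail_sign e"
    by (simp add: fun_eq_iff swallowtail_sign_def power4_eq_xxxx mult.assoc)
  ultimately have "jet_eq r h (swallowtail_sign e)" using r jet_eq_mono jet_eq_sym by fastforce
  then have "A_equivalent (swallowtail_sign e) h"
    using assms sh by (simp add: r_determined_def jet_eq_iff)
  moreover have "\<not> A_equivalent (swallowtail_sign e) h"
    by (rule not_A_equivalent_fibre[OF sg])
      (auto simp: swallowtail_sign_def h_def vec_eq_iff forall_2 axis_def)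
  ultimately show False by blast
qed

section \<open>Growth of germs along a half-axis\<close>

lemma tendsto_axis:
  assumes "smooth_near_0 (F :: real^2 \<Rightarrow> real)"
  shows "((\<lambda>s. F (s *\<^sub>R axis 1 1)) \<longlongrightarrow> F 0) (at_right (0::real))"
proof -
  have "((\<lambda>s::real. s *\<^sub>R (axis 1 1 :: real^2)) \<longlongrightarrow> 0) (at_right 0)"
    by (auto intro!: tendsto_eq_intros)
  then show ?thesis using isCont_tendsto_compose[OF smooth_near_0_isCont[OF assms]] by blast
qed

text \<open>Taylor's theorem with Peano remainder on the positive half-axis: by l'Hospital the
  quotient reduces to the derivative along e_1, whose jet of one order less vanishes.\<close>

lemma jet_eq_zero_axis_limit:
  fixes F :: "real^2 \<Rightarrow> real"
  assumes "smooth_near_0 F" "jet_eq k F (\<lambda>x. 0)"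
  shows "((\<lambda>s. F (s *\<^sub>R axis 1 1) / s ^ k) \<longlongrightarrow> 0) (at_right (0::real))"
  using assms
proof (induction k arbitrary: F)
  case 0
  then show ?case using tendsto_axis[OF 0(1)] by (simp add: jet_eq_0)
next
  case (Suc k)
  let ?G = "\<lambda>x. frechet_derivative F (at x) (axis 1 1)"
  have IH: "((\<lambda>s. ?G (s *\<^sub>R axis 1 1) / s ^ k) \<longlongrightarrow> 0) (at_right (0::real))"
    by (rule Suc.IH; use Suc.prems in \<open>simp add: smooth_near_0_deriv jet_eq_Suc\<close>)
  show ?case
  proof (rule lhopital_right_0)
    show "((\<lambda>s. F (s *\<^sub>R axis 1 1)) \<longlongrightarrow> 0) (at_right (0::real))"
      using tendsto_axis[OF Suc.prems(1)] jet_eq_value[OF Suc.prems(2)] by simp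
    show "((\<lambda>s. s ^ Suc k) \<longlongrightarrow> 0) (at_right (0::real))"
      by (auto intro!: tendsto_eq_intros)
    show "\<forall>\<^sub>F s in at_right 0. s ^ Suc k \<noteq> (0::real)"
      using eventually_at_right_less by eventually_elim simp
    show "\<forall>\<^sub>F s in at_right 0. real (Suc k) * s ^ k \<noteq> 0"
      using eventually_at_right_less by eventually_elim simp
    have "\<forall>\<^sub>F s in nhds (0::real). F differentiable (at (s *\<^sub>R axis 1 1))"
      by (rule ev_axis[OF smooth_near_0_differentiable[OF Suc.prems(1)]])
    then have "\<forall>\<^sub>F s in at_right (0::real). F differentiable (at (s *\<^sub>R axis 1 1))"
      unfolding eventually_at_filter by eventually_elim simp
    then show "\<forall>\<^sub>F s in at_right 0. ((\<lambda>s. F (s *\<^sub>R axis 1 1)) has_real_derivative ?G (s *\<^sub>R axis 1 1)) (at s)"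
      by eventually_elim (rule frechet_derivative_axis)
    show "\<forall>\<^sub>F s in at_right 0. ((\<lambda>s. s ^ Suc k) has_real_derivative real (Suc k) * s ^ k) (at s)"
      using DERIV_pow[of "Suc k"] by (simp add: always_eventually)
    show "((\<lambda>s. ?G (s *\<^sub>R axis 1 1) / (real (Suc k) * s ^ k)) \<longlongrightarrow> 0) (at_right 0)"
      using tendsto_divide[OF IH tendsto_const[of "real (Suc k)"]] by (simp add: mult.commute)
  qed
qed

lemma tendsto_vec_2:
  fixes y :: "'a \<Rightarrow> real^2"
  assumes "((\<lambda>s. y s $ 1) \<longlongrightarrow> a $ 1) F" "((\<lambda>s. y s $ 2) \<longlongrightarrow> a $ 2) F"
  shows "(y \<longlongrightarrow> a) F"
proof (rule vec_tendstoI)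
  fix i :: 2
  show "((\<lambda>s. y s $ i) \<longlongrightarrow> a $ i) F" using assms exhaust_2[of i] by auto
qed

text \<open>The first-order expansion of \<open>f\<close> at 0 is divided by the scale
  \<open>c\<close>: the relative error tends to 0 because \<open>y\<close> does, and it is
  multiplied by the convergent quantity norm y / c. Used with c = s^4, a scale different from the
  parameter.\<close>

lemma differentiable_weighted_limit:
  fixes f :: "'a::real_normed_vector \<Rightarrow> 'b::real_normed_vector" and c :: "'c \<Rightarrow> real"
  assumes "(f has_derivative f') (at 0)" "f 0 = 0"
    and y: "((\<lambda>s. y s /\<^sub>R c s) \<longlongrightarrow> w) F" and c: "(c \<longlongrightarrow> 0) F" "\<forall>\<^sub>F s in F. c s > 0"
  shows "((\<lambda>s. f (y s) /\<^sub>R c s) \<longlongrightarrow> f' w) F"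
proof -
  \<comment> \<open>Since division by 0 gives 0, \<open>e 0 = 0\<close>; so \<open>e\<close> is
    continuous at 0 and parameters with \<open>y s = 0\<close> need no exclusion.\<close>
  define e where "e z = (f z - f' z) /\<^sub>R norm z" for z
  have lin: "bounded_linear f'" using assms(1) by (rule has_derivative_bounded_linear)
  have "(e \<longlongrightarrow> 0) (at 0)"
  proof (rule tendsto_norm_zero_cancel)
    have "norm (e z) = norm (f (0 + z) - f 0 - f' z) / norm z" for z
      by (simp add: e_def assms(2) divide_inverse mult.commute)
    then show "((\<lambda>z. norm (e z)) \<longlongrightarrow> 0) (at 0)"
      using assms(1) by (simp add: has_derivative_at)
  qed
  then have e0: "(e \<longlongrightarrow> e 0) (nhds 0)"
    using tendsto_at_iff_tendsto_nhds[of e 0] by (simp add: e_def)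
  have "((\<lambda>s. c s *\<^sub>R (y s /\<^sub>R c s)) \<longlongrightarrow> 0 *\<^sub>R w) F"
    by (intro tendsto_intros c y)
  moreover have "\<forall>\<^sub>F s in F. c s *\<^sub>R (y s /\<^sub>R c s) = y s" using c(2) by eventually_elim simp
  ultimately have "(y \<longlongrightarrow> 0) F" using tendsto_cong by force
  then have ey: "((\<lambda>s. e (y s)) \<longlongrightarrow> 0) F"
    using filterlim_compose[OF e0] by (simp add: e_def)
  have "((\<lambda>s. f' (y s /\<^sub>R c s) + norm (y s /\<^sub>R c s) *\<^sub>R e (y s)) \<longlongrightarrow> f' w + norm w *\<^sub>R 0) F"
    by (intro tendsto_intros bounded_linear.tendsto[OF lin] y ey)
  moreover have "\<forall>\<^sub>F s in F. f' (y s /\<^sub>R c s) + norm (y s /\<^sub>R c s) *\<^sub>R e (y s) = f (y s) /\<^sub>R c s"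
    using c(2)
  proof eventually_elim
    case (elim s)
    have "norm (y s) *\<^sub>R e (y s) = f (y s) - f' (y s)"
      using linear_0[OF bounded_linear.linear[OF lin]] assms(2) by (cases "y s = 0") (simp_all add: e_def)
    then have "(norm (y s) / c s) *\<^sub>R e (y s) = (f (y s) - f' (y s)) /\<^sub>R c s"
      by (metis divide_inverse_commute scaleR_scaleR)
    then show ?case
      using elim by (simp add: linear_scale[OF bounded_linear.linear[OF lin]] divide_inverse
          mult.commute scaleR_diff_right)
  qed
  ultimately show ?thesis using tendsto_cong by force
qed

text \<open>If \<open>h = \<psi> \<circ> swallowtail \<circ> \<phi>\<close> has the \<open>4\<close>-jet of the other normal form, then on the \<open>x\<^sub>1\<close>-axis \<open>h\<close> is
  \<open>s\<^sup>4 e\<^sub>1\<close> up to \<open>o(s\<^sup>4)\<close>, so \<open>s\<^sup>-\<^sup>4 swallowtail (\<phi> (s e\<^sub>1))\<close> tends to \<open>d\<psi>\<^sup>-\<^sup>1 e\<^sub>1\<close> and the first coordinate of the latter is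
  a limit of fourth powers. The derivative of \<open>\<lambda>\<^sub>h\<close> along \<open>x\<^sub>2\<close> and the two orientations make it negative.\<close>

lemma swallowtail_not_isotopic: "\<not> A_isotopic r (swallowtail_sign 1) (swallowtail_sign (-1))"
proof
  let ?g = "swallowtail_sign (-1)" and ?e = "axis 1 1 :: real^2" and ?e2 = "axis 2 1 :: real^2"
  have sw1: "swallowtail_sign 1 = swallowtail"
    by (simp add: fun_eq_iff swallowtail_sign_dmat dmat_mult swallowtail_def)
  assume "A_isotopic r (swallowtail_sign 1) ?g"
  then have iso: "A_isotopic r swallowtail ?g" unfolding sw1 .
  then have r: "r \<ge> 4" using r_determined_swallowtail_sign unfolding A_isotopic_def by blast
  obtain \<phi> \<psi> where *: "diffeo_germ \<phi>" "diffeo_germ \<psi>" "jac_det \<phi> 0 > 0" "jac_det \<psi> 0 > 0"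
    "jet_eq r ?g (\<lambda>x. \<psi> (swallowtail (\<phi> x)))"
    using A_isotopicD[OF iso] r by auto
  let ?h = "\<lambda>x. \<psi> (swallowtail (\<phi> x))"
  note G = *(1,2)[THEN diffeo_germ_smooth] and D = smooth_germD
  note d0 = smooth_near_0_differentiable_0[OF D(1)]
  have ge: "?g = (\<lambda>x. swallowtail (dmat (-1) 1 *v x))"
    by (simp add: fun_eq_iff swallowtail_sign_dmat)
  have sg: "smooth_germ ?g"
    unfolding ge using smooth_germ_compose[OF smooth_germ_swallowtail smooth_germ_matrix] .
  note sw\<phi> = smooth_germ_compose[OF smooth_germ_swallowtail G(1)]
  have sh: "smooth_germ ?h" using smooth_germ_compose[OF G(2) sw\<phi>] .
  have fm: "frechet_derivative (\<lambda>x. dmat (-1) 1 *v x) (at 0) v = dmat (-1) 1 *v v" for v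
    by (rule frechet_derivative_eqI[OF bounded_linear_imp_has_derivative[OF matrix_vector_mul_bounded_linear]])
  have Dg: "frechet_derivative ?g (at 0) v = vector [0, v $ 2]" for v
    unfolding ge
    by (subst frechet_derivative_chain[of "\<lambda>x. dmat (-1) 1 *v x"])
      (simp_all add: d0 smooth_germ_matrix smooth_germ_swallowtail frechet_swallowtail fm dmat_mult)
  have gh: "frechet_derivative ?h (at 0) b = frechet_derivative ?g (at 0) b" if "b \<in> Basis" for b
    using frechet_eq_jet_eq[OF *(5) _ that] r by simp
  have "frechet_derivative ?h (at 0) ?e = 0"
    by (simp add: gh Dg vector_2_zero) (simp add: axis_def vector_2_zero)
  then have k: "frechet_derivative \<phi> (at 0) ?e $ 2 = 0"
    by (intro isotopic_kernel[OF G(1) *(2) smooth_germ_swallowtail]) (simp_all add: swallowtail_def)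
  let ?\<beta> = "frechet_derivative \<phi> (at 0) ?e2 $ 2"
  have "jet_eq 3 (jac_det ?g) (jac_det ?h)"
    using jet_eq_jac_det[of ?g ?h 3] sg sh jet_eq_mono[OF *(5)] r by (simp add: D)
  then have "dir_deriv (\<lambda>_. ?e2) (jac_det ?g) 0 = dir_deriv (\<lambda>_. ?e2) (jac_det ?h) 0"
    unfolding dir_deriv_def by (intro frechet_eq_jet_eq) auto
  moreover have "dir_deriv (\<lambda>_. ?e2) (jac_det ?h) 0 = jac_det \<psi> 0 * jac_det \<phi> 0 * ?\<beta>"
    by (rule swallowtail_xi[OF G(2,1)]) simp
  moreover have "dir_deriv (\<lambda>_. ?e2) (jac_det ?g) 0 = -1"
    using swallowtail_xi[OF smooth_germ_id smooth_germ_matrix[of "dmat (-1) 1"], of ?g "\<lambda>_. ?e2"]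
    by (simp add: ge jac_det_id jac_det_matrix det_dmat fm) (simp add: dmat_mult axis_def)
  \<comment> \<open>The derivative of \<lambda> along x_2 is shared by both germs through their
    jets. It is -1 for \<open>?g\<close>, and positivity of both determinants passes this sign to
    \<open>?\<beta>\<close>.\<close>
  ultimately have "(jac_det \<psi> 0 * jac_det \<phi> 0) * ?\<beta> = -1" by simp
  moreover have "jac_det \<psi> 0 * jac_det \<phi> 0 > 0" using *(3,4) by simp
  ultimately have \<beta>: "?\<beta> < 0" by (smt (verit) mult_nonneg_nonneg)
  obtain \<psi>' where p: "diffeo_germ \<psi>'" "\<forall>\<^sub>F x in nhds 0. \<psi>' (\<psi> x) = x" "\<forall>\<^sub>F x in nhds 0. \<psi> (\<psi>' x) = x"
    by (rule diffeo_germ_inverse[OF *(2)])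
  note G' = diffeo_germ_smooth[OF p(1)]
  have \<psi>h: "\<forall>\<^sub>F x in nhds 0. \<psi>' (?h x) = swallowtail (\<phi> x)"
    by (rule smooth_germ_ev_compose[OF p(2) sw\<phi>])
  let ?D = "frechet_derivative \<psi>' (at 0)"
  have dsw: "frechet_derivative (\<lambda>x. swallowtail (\<phi> x)) (at 0) v = vector [0, frechet_derivative \<phi> (at 0) v $ 2]" for v
    by (subst frechet_derivative_chain) (simp_all add: d0 G D(2)[OF G(1)] smooth_germ_swallowtail frechet_swallowtail)
  have "?D (frechet_derivative ?h (at 0) ?e2) = frechet_derivative (\<lambda>x. \<psi>' (?h x)) (at 0) ?e2"
    using frechet_derivative_chain[of ?h 0 \<psi>'] d0[OF sh] d0[OF G'] D(2)[OF sh] by simp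
  also have "\<dots> = vector [0, ?\<beta>]"
    unfolding frechet_derivative_cong_ev[OF \<psi>h] dsw ..
  also have "frechet_derivative ?h (at 0) ?e2 = ?e2"
    by (simp add: gh Dg) (simp add: axis_def vec_eq_iff forall_2)
  finally have D2: "?D ?e2 = vector [0, ?\<beta>]" .
  have "jac_det \<psi>' 0 * jac_det \<psi> 0 = 1"
    by (rule jac_det_diffeo_inverse[OF G(2) G' p(2)])
  then have "jac_det \<psi>' 0 > 0" using *(4) by (metis zero_less_mult_pos2 zero_less_one)
  \<comment> \<open>The second column of \<open>?D\<close> is (0, \<open>?\<beta>\<close>), so its
    determinant is \<open>?D ?e $ 1\<close> times \<open>?\<beta>\<close>. It is positive because
    \<open>\<psi>\<close> preserves orientation.\<close>
  then have D1: "?D ?e $ 1 < 0"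
    using \<beta> by (simp add: jac_det_formula D2 zero_less_mult_iff)
  have lim: "((\<lambda>s. (?h (s *\<^sub>R ?e) $ i - ?g (s *\<^sub>R ?e) $ i) / s ^ 4) \<longlongrightarrow> 0) (at_right (0::real))" for i
  proof (rule jet_eq_zero_axis_limit)
    show "smooth_near_0 (\<lambda>x. ?h x $ i - ?g x $ i)"
      by (intro smooth_near_0_diff smooth_near_0_nth D(1) sg sh)
    have "jet_eq 4 ?h ?g" using jet_eq_sym[OF jet_eq_mono[OF *(5) r]] .
    then have "jet_eq 4 (\<lambda>x. ?h x $ i) (\<lambda>x. ?g x $ i)"
      by (rule jet_eq_linear[OF bounded_linear_vec_nth D(1)[OF sh] D(1)[OF sg]])
    then have "jet_eq 4 (\<lambda>x. ?h x $ i - ?g x $ i) (\<lambda>x. ?g x $ i - ?g x $ i)"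
      by (intro jet_eq_diff smooth_near_0_nth D(1) sg sh jet_eq_refl)
    then show "jet_eq 4 (\<lambda>x. ?h x $ i - ?g x $ i) (\<lambda>x. 0)" by simp
  qed
  have pos: "\<forall>\<^sub>F s in at_right (0::real). 0 < s" by (rule eventually_at_right_less)
  have ax: "?e $ 1 = 1" "?e $ 2 = 0" by (simp_all add: axis_def)
  have hlim: "((\<lambda>s. ?h (s *\<^sub>R ?e) /\<^sub>R s ^ 4) \<longlongrightarrow> ?e) (at_right (0::real))"
  proof (rule tendsto_vec_2)
    have "((\<lambda>s. (?h (s *\<^sub>R ?e) $ 1 - ?g (s *\<^sub>R ?e) $ 1) / s ^ 4 + 1) \<longlongrightarrow> 0 + 1) (at_right (0::real))"
      by (intro tendsto_add lim tendsto_const)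
    moreover have "\<forall>\<^sub>F s in at_right (0::real).
       (?h (s *\<^sub>R ?e) $ 1 - ?g (s *\<^sub>R ?e) $ 1) / s ^ 4 + 1 = (?h (s *\<^sub>R ?e) /\<^sub>R s ^ 4) $ 1"
      using pos by eventually_elim (simp add: swallowtail_sign_def ax divide_inverse_commute right_diff_distrib)
    ultimately show "((\<lambda>s. (?h (s *\<^sub>R ?e) /\<^sub>R s ^ 4) $ 1) \<longlongrightarrow> ?e $ 1) (at_right (0::real))"
      using tendsto_cong by (force simp: ax)
    show "((\<lambda>s. (?h (s *\<^sub>R ?e) /\<^sub>R s ^ 4) $ 2) \<longlongrightarrow> ?e $ 2) (at_right (0::real))"
      using lim[of 2] by (simp add: swallowtail_sign_def ax divide_inverse_commute)
  qed
  have "((\<lambda>s. \<psi>' (?h (s *\<^sub>R ?e)) /\<^sub>R s ^ 4) \<longlongrightarrow> ?D ?e) (at_right (0::real))"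
  proof (rule differentiable_weighted_limit[where y = "\<lambda>s. ?h (s *\<^sub>R ?e)", OF _ _ hlim])
    show "\<psi>' 0 = 0" using D(2)[OF G'] .
    show "(\<psi>' has_derivative ?D) (at 0)" using d0[OF G'] by (simp add: frechet_derivative_works)
    show "((\<lambda>s. s ^ 4) \<longlongrightarrow> 0) (at_right (0::real))" by (auto intro!: tendsto_eq_intros)
    show "\<forall>\<^sub>F s in at_right (0::real). s ^ 4 > 0" using pos by eventually_elim simp
  qed
  moreover have ev: "\<forall>\<^sub>F s in at_right (0::real). \<psi>' (?h (s *\<^sub>R ?e)) = swallowtail (\<phi> (s *\<^sub>R ?e))"
    using ev_axis[OF \<psi>h] unfolding eventually_at_filter by eventually_elim simp
  then have "\<forall>\<^sub>F s in at_right (0::real). \<psi>' (?h (s *\<^sub>R ?e)) /\<^sub>R s ^ 4 = swallowtail (\<phi> (s *\<^sub>R ?e)) /\<^sub>R s ^ 4"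
    by eventually_elim simp
  ultimately have sl: "((\<lambda>s. swallowtail (\<phi> (s *\<^sub>R ?e)) /\<^sub>R s ^ 4) \<longlongrightarrow> ?D ?e) (at_right (0::real))"
    using tendsto_cong by fast
  let ?p = "\<lambda>s. \<phi> (s *\<^sub>R ?e) $ 1" and ?q = "\<lambda>s. \<phi> (s *\<^sub>R ?e) $ 2"
  \<comment> \<open>The second coordinate of the swallowtail is \<open>?q\<close>, so
    \<open>?q s / s ^ 4\<close> converges; as \<open>?p\<close> tends to 0, the mixed term
    disappears and only the nonnegative quotient \<open>?p s ^ 4 / s ^ 4\<close> contributes to the
    limit.\<close>
  have l1: "((\<lambda>s. ?p s ^ 4 / s ^ 4 + ?p s * (?q s / s ^ 4)) \<longlongrightarrow> ?D ?e $ 1) (at_right (0::real))"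
    using tendsto_vec_nth[OF sl, of 1]
    by (simp add: swallowtail_def divide_inverse_commute distrib_left mult.left_commute)
  have l2: "((\<lambda>s. ?q s / s ^ 4) \<longlongrightarrow> ?D ?e $ 2) (at_right (0::real))"
    using tendsto_vec_nth[OF sl, of 2] by (simp add: swallowtail_def divide_inverse_commute)
  have "(?p \<longlongrightarrow> 0) (at_right (0::real))"
    using tendsto_axis[OF smooth_near_0_nth[OF D(1)[OF G(1)]], of 1] D(2)[OF G(1)] by simp
  from tendsto_diff[OF l1 tendsto_mult[OF this l2]]
  have "((\<lambda>s. ?p s ^ 4 / s ^ 4) \<longlongrightarrow> ?D ?e $ 1) (at_right (0::real))" by simp
  then have "?D ?e $ 1 \<ge> 0"
    by (rule tendsto_lowerbound) (simp_all add: always_eventually)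
  then show False using D1 by simp
qed

theorem theorem4p2:
  fixes f :: "real^2 \<Rightarrow> real^2" and \<epsilon> :: real
  assumes "smooth_germ f" and "\<epsilon> \<in> {1, -1}"
  shows
    "((\<forall>r \<eta>. A_equivalent f lips \<and> r_determined r f \<and> null_field f \<eta> \<and>
           sgn (dir_deriv \<eta> (dir_deriv \<eta> (jac_det f)) 0) = \<epsilon>
         \<longrightarrow> A_isotopic r f (lips_sign \<epsilon>))
       \<and> (\<forall>r. \<not> A_isotopic r (lips_sign 1) (lips_sign (-1))))
   \<and> ((\<forall>r \<eta>. A_equivalent f beaks \<and> r_determined r f \<and> null_field f \<eta> \<and>
           sgn (dir_deriv \<eta> (dir_deriv \<eta> (jac_det f)) 0) = \<epsilon>
         \<longrightarrow> A_isotopic r f (beaks_sign \<epsilon>))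
       \<and> (\<forall>r. \<not> A_isotopic r (beaks_sign 1) (beaks_sign (-1))))
   \<and> ((\<forall>r \<eta> \<xi>. A_equivalent f swallowtail \<and> r_determined r f \<and> null_field f \<eta> \<and>
           smooth_near_0 \<xi> \<and> positive_frame (\<eta> 0) (\<xi> 0) \<and>
           sgn (dir_deriv \<xi> (jac_det f) 0 *
                dir_deriv \<eta> (dir_deriv \<eta> (dir_deriv \<eta> (jac_det f))) 0) = \<epsilon>
         \<longrightarrow> A_isotopic r f (swallowtail_sign \<epsilon>))
       \<and> (\<forall>r. \<not> A_isotopic r (swallowtail_sign 1) (swallowtail_sign (-1))))"
proof -
  have L: "lips = cubic 1" "lips_sign e = (\<lambda>x. dmat e 1 *v cubic 1 x)" "lips_sign 1 = cubic 1"
    and B: "beaks = cubic (-1)" "beaks_sign e = (\<lambda>x. dmat e 1 *v cubic (-1) x)" "beaks_sign 1 = cubic (-1)" for e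
    by (simp_all add: fun_eq_iff lips_def lips_sign_def beaks_def beaks_sign_def cubic_def dmat_mult
        power2_eq_square power3_eq_cube algebra_simps)
  have "A_isotopic r f (lips_sign \<epsilon>)"
    if "A_equivalent f lips \<and> r_determined r f \<and> null_field f \<eta> \<and>
           sgn (dir_deriv \<eta> (dir_deriv \<eta> (jac_det f)) 0) = \<epsilon>" for r \<eta>
    unfolding L(2) by (rule cubic_isotopic[OF assms(1) _ _ _ assms(2)]) (use that L(1) in auto)
  moreover have "A_isotopic r f (beaks_sign \<epsilon>)"
    if "A_equivalent f beaks \<and> r_determined r f \<and> null_field f \<eta> \<and>
           sgn (dir_deriv \<eta> (dir_deriv \<eta> (jac_det f)) 0) = \<epsilon>" for r \<eta>
    unfolding B(2) by (rule cubic_isotopic[OF assms(1) _ _ _ assms(2)]) (use that B(1) in auto)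
  moreover have "A_isotopic r f (swallowtail_sign \<epsilon>)"
    if "A_equivalent f swallowtail \<and> r_determined r f \<and> null_field f \<eta> \<and>
           smooth_near_0 \<xi> \<and> positive_frame (\<eta> 0) (\<xi> 0) \<and>
           sgn (dir_deriv \<xi> (jac_det f) 0 *
                dir_deriv \<eta> (dir_deriv \<eta> (dir_deriv \<eta> (jac_det f))) 0) = \<epsilon>" for r \<eta> \<xi>
    by (rule swallowtail_isotopic[OF assms(1) _ _ _ _ assms(2)]) (use that in auto)
  moreover have "\<not> A_isotopic r (lips_sign 1) (lips_sign (-1))" for r
    using cubic_not_isotopic[of r 1] unfolding L(3) L(2)[of "-1"] .
  moreover have "\<not> A_isotopic r (beaks_sign 1) (beaks_sign (-1))" for r
    using cubic_not_isotopic[of r "-1"] unfolding B(3) B(2)[of "-1"] .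
  ultimately show ?thesis using swallowtail_not_isotopic by blast
qed

end
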